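(* There exist absolute constants $c, C>0$ such that for all integers $n$ and $k\geq 2$, the minimum number $T(n,k)$ of adaptive queries needed to solve black-peg Mastermind with $n$ positions and $k$ colors satisfies $$c\left(n\frac{\log k}{\log n}+k\right)\leq T(n,k)\leq C\left(n\frac{\log k}{\log n}+k\right),$$ i.e. $T(n,k)=\Theta\left(n\frac{\log k}{\log n}+k\right)$.
   Context: Black-peg Mastermind with $n$ positions and $k$ colors: Codemaker chooses a hidden codeword $x\in[k]^n$. Codebreaker adaptively asks queries $q\in[k]^n$ (each query may depend on all previous answers) and after each query is told the number of black pegs $bp(x,q)=|\{i\in[n]: x_i=q_i\}|$. The game is solved once the answers received determine $x$ uniquely, i.e. every $x'\neq x$ in $[k]^n$ would have given a different answer to at least one of the queries asked. The minimum number of adaptive queries needed is the least $T$ such that Codebreaker has an adaptive strategy that determines every possible codeword within $T$ queries. *)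

theory Defs
  imports "HOL-Analysis.Analysis" "HOL-Library.FuncSet"
begin

type_synonym code = "nat \<Rightarrow> nat"

definition codewords :: "nat \<Rightarrow> nat \<Rightarrow> code set" where
  "codewords n k = {1..n} \<rightarrow>\<^sub>E {1..k}"

definition black_pegs :: "nat \<Rightarrow> code \<Rightarrow> code \<Rightarrow> nat" where
  "black_pegs n x q = card {i \<in> {1..n}. x i = q i}"

text \<open>
  A history lists the queries asked so far with their answers, oldest first. A deterministic
  adaptive strategy chooses the next query as a function of the history.
\<close>

type_synonym history = "(code \<times> nat) list"

definition strategy :: "nat \<Rightarrow> nat \<Rightarrow> (history \<Rightarrow> code) \<Rightarrow> bool" where
  "strategy n k \<sigma> \<longleftrightarrow> (\<forall>h. \<sigma> h \<in> codewords n k)"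

primrec play :: "nat \<Rightarrow> (history \<Rightarrow> code) \<Rightarrow> code \<Rightarrow> nat \<Rightarrow> history" where
  "play n \<sigma> x 0 = []"
| "play n \<sigma> x (Suc t) =
     (let h = play n \<sigma> x t; q = \<sigma> h in h @ [(q, black_pegs n x q)])"

text \<open>
  Solved means that the answers leave no other candidate; the codeword itself need not have
  been asked as a query.
\<close>

definition solved :: "nat \<Rightarrow> nat \<Rightarrow> code \<Rightarrow> history \<Rightarrow> bool" where
  "solved n k x h \<longleftrightarrow>
     (\<forall>x' \<in> codewords n k. x' \<noteq> x \<longrightarrow> (\<exists>(q, a) \<in> set h. black_pegs n x' q \<noteq> a))"

definition solvable_within :: "nat \<Rightarrow> nat \<Rightarrow> nat \<Rightarrow> bool" where
  "solvable_within n k T \<longleftrightarrow>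
     (\<exists>\<sigma>. strategy n k \<sigma> \<and>
        (\<forall>x \<in> codewords n k. \<exists>t \<le> T. solved n k x (play n \<sigma> x t)))"

definition min_queries :: "nat \<Rightarrow> nat \<Rightarrow> nat" where
  "min_queries n k = (LEAST T. solvable_within n k T)"

lemma black_pegs_less:
  assumes "x \<in> codewords n k" "x' \<in> codewords n k" "x' \<noteq> x"
  shows "black_pegs n x' x < black_pegs n x x"
proof -
  obtain i where i: "i \<in> {1..n}" "x' i \<noteq> x i"
    using PiE_ext[of x' "{1..n}" "\<lambda>_. {1..k}" x] assms
    unfolding codewords_def by blast
  have "{i \<in> {1..n}. x' i = x i} \<subset> {i \<in> {1..n}. x i = x i}"
    using i by blast
  then show ?thesis
    unfolding black_pegs_def by (intro psubset_card_mono) auto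
qed

text \<open>
  The minimum in \<^const>\<open>min_queries\<close> is attained: asking all codewords in turn solves the game.
\<close>

lemma solvable_within_exists:
  assumes "k \<ge> 1"
  shows "\<exists>T. solvable_within n k T"
proof -
  have "finite (codewords n k)"
    unfolding codewords_def by (intro finite_PiE) auto
  then obtain qs where qs: "set qs = codewords n k"
    using finite_list by blast
  have "codewords n k \<noteq> {}"
    using assms unfolding codewords_def by (simp add: PiE_eq_empty_iff)
  then have ne: "qs \<noteq> []" using qs by auto
  define \<sigma> :: "history \<Rightarrow> code"
    where "\<sigma> h = (if length h < length qs then qs ! length h else hd qs)" for h
  have strat: "strategy n k \<sigma>"
    unfolding strategy_def \<sigma>_def qs[symmetric]
    using ne by (simp)
  have ask: "\<sigma> h = qs ! length h" if "length h < length qs" for h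
    using that unfolding \<sigma>_def by simp
  have len: "length (play n \<sigma> x t) = t" for x t
    by (induction t) (auto simp: Let_def)
  have mem: "(qs ! i, black_pegs n x (qs ! i)) \<in> set (play n \<sigma> x t)"
    if "i < t" "t \<le> length qs" for x t i
    using that
  proof (induction t)
    case (Suc t)
    then show ?case
      by (cases "i = t") (simp_all add: Let_def ask len)
  qed simp
  have "solved n k x (play n \<sigma> x (length qs))" if x: "x \<in> codewords n k" for x
  proof -
    obtain i where "i < length qs" "qs ! i = x"
      using x qs by (metis in_set_conv_nth)
    then have "(x, black_pegs n x x) \<in> set (play n \<sigma> x (length qs))"
      using mem by blast
    moreover have "black_pegs n x' x \<noteq> black_pegs n x x"
      if "x' \<in> codewords n k" "x' \<noteq> x" for x'
      using black_pegs_less[OF x that] by simp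
    ultimately show ?thesis
      unfolding solved_def by (intro ballI impI bexI[of _ "(x, black_pegs n x x)"]) simp_all
  qed
  then have "solvable_within n k (length qs)"
    using strat unfolding solvable_within_def by blast
  then show ?thesis ..
qed

end

theory Submission
  imports Defs "HOL-Library.Extended_Nat"
begin

text \<open>
  The lower bound combines counting answer sequences with an adversary that answers zero.

  For the upper bound, suppose \<open>2 ^ r\<close> searches run on disjoint sets of positions, and let \<open>A i\<close> for
  \<open>i \<subseteq> {..<r}\<close> be the answers to their next queries. Instead of these one asks for the sums
  \<open>\<Sum>i. (-1) ^ card (R \<inter> i) * A i\<close> with \<open>R \<subseteq> {..<r}\<close>. Summing over all \<open>Q \<subseteq> R\<close> gives a multiple of
  \<open>2 ^ card R\<close>, so the query for \<open>R\<close> can carry, on further positions, one more question whose answer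
  is known to lie in a range of size at most \<open>2 ^ card R\<close>: its answer is read off modulo \<open>2 ^ card R\<close>. With
  \<open>r = 2 * j + 1\<close>, half of the \<open>2 ^ r\<close> queries can carry a question of range \<open>2 ^ (j + 1)\<close>.

  Fewer than \<open>k\<close> positions are solved by \<open>O(k)\<close> queries as follows. The number of occurrences of each
  colour is found directly. A colour occurring between \<open>2 ^ j\<close> and \<open>2 ^ (j + 1) - 1\<close> times in a set is
  then searched for by bisection until it occurs less than \<open>2 ^ j\<close> times in each piece, for \<open>j\<close>
  decreasing to \<open>0\<close>. In round \<open>j\<close> there are only \<open>O(k / 2 ^ j)\<close> such pieces, and the free questions
  reduce the cost of a round from \<open>O(log k)\<close> to \<open>O(j + 1)\<close> queries per piece; these costs sum to \<open>O(k)\<close>.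

  Finally, the \<open>n / (k - 1)\<close> blocks are solved simultaneously, again with the free questions. Nesting this
  \<open>L\<close> times, with \<open>L\<close> of order \<open>log n / log k\<close>, saves a factor of order \<open>L\<close>.
\<close>

section \<open>Adaptive learning with difference queries\<close>

text \<open>Every answer shrinks the set of remaining candidates; a goal of this kind, once reached,
  is not lost by asking more.\<close>

definition hereditary :: "('a set \<Rightarrow> bool) \<Rightarrow> bool" where
  "hereditary G \<longleftrightarrow> (\<forall>X Y. G X \<longrightarrow> Y \<subseteq> X \<longrightarrow> G Y)"

lemma hereditaryI: "(\<And>X Y. G X \<Longrightarrow> Y \<subseteq> X \<Longrightarrow> G Y) \<Longrightarrow> hereditary G"
  unfolding hereditary_def by blast

lemma hereditaryD: "hereditary G \<Longrightarrow> G X \<Longrightarrow> Y \<subseteq> X \<Longrightarrow> G Y"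
  unfolding hereditary_def by blast

lemma hereditary_ball: "(\<And>i. i \<in> I \<Longrightarrow> hereditary (G i)) \<Longrightarrow> hereditary (\<lambda>Z. \<forall>i\<in>I. G i Z)"
  unfolding hereditary_def by blast

lemma hereditary_constant_on: "hereditary (\<lambda>Z. f constant_on Z)"
  unfolding hereditary_def constant_on_def by blast

lemma constant_onD: "f constant_on Z \<Longrightarrow> x \<in> Z \<Longrightarrow> y \<in> Z \<Longrightarrow> f x = f y"
  unfolding constant_on_def by metis

lemma constant_onI: "(\<And>x y. x \<in> Z \<Longrightarrow> y \<in> Z \<Longrightarrow> f x = f y) \<Longrightarrow> f constant_on Z"
  unfolding constant_on_def by metis

text \<open>
  Differences of two black-peg answers allow signed queries without a colour known to be absent:
  positions where the two queries coincide do not contribute.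
\<close>

definition diff_queries :: "nat \<Rightarrow> nat set \<Rightarrow> (code \<Rightarrow> int) set" where
  "diff_queries k U = {\<lambda>x. \<Sum>i\<in>U. of_bool (x i = p i) - of_bool (x i = q i) | p q.
     range p \<subseteq> {1..k} \<and> range q \<subseteq> {1..k}}"

lemma diff_queriesI:
  assumes "range p \<subseteq> {1..k}" "range q \<subseteq> {1..k}"
  shows "(\<lambda>x. \<Sum>i\<in>U. of_bool (x i = p i) - of_bool (x i = q i)) \<in> diff_queries k U"
  using assms unfolding diff_queries_def by blast

lemma diff_queriesE:
  assumes "\<phi> \<in> diff_queries k U"
  obtains p q where "range p \<subseteq> {1..k}" "range q \<subseteq> {1..k}"
    "\<phi> = (\<lambda>x. \<Sum>i\<in>U. of_bool (x i = p i) - of_bool (x i = q i))"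
  using assms unfolding diff_queries_def by blast

lemma diff_queries_zero:
  assumes "k \<ge> 1"
  shows "(\<lambda>x. 0) \<in> diff_queries k U"
  using diff_queriesI[of "\<lambda>_. 1" k "\<lambda>_. 1" U] assms by (simp add: image_subset_iff)

lemma diff_queries_uminus:
  assumes "\<phi> \<in> diff_queries k U"
  shows "(\<lambda>x. - \<phi> x) \<in> diff_queries k U"
proof -
  obtain p q where *: "range p \<subseteq> {1..k}" "range q \<subseteq> {1..k}"
    "\<phi> = (\<lambda>x. \<Sum>i\<in>U. of_bool (x i = p i) - of_bool (x i = q i))"
    using diff_queriesE[OF assms] .
  show ?thesis
    using diff_queriesI[OF *(2,1), of U] unfolding *(3) by (simp add: sum_negf[symmetric])
qed

lemma diff_queries_add:
  assumes "\<phi> \<in> diff_queries k U" "\<psi> \<in> diff_queries k V" "finite U" "finite V" "U \<inter> V = {}"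
  shows "(\<lambda>x. \<phi> x + \<psi> x) \<in> diff_queries k (U \<union> V)"
proof -
  obtain p q where 1: "range p \<subseteq> {1..k}" "range q \<subseteq> {1..k}"
    "\<phi> = (\<lambda>x. \<Sum>i\<in>U. of_bool (x i = p i) - of_bool (x i = q i))"
    using diff_queriesE[OF assms(1)] .
  obtain p' q' where 2: "range p' \<subseteq> {1..k}" "range q' \<subseteq> {1..k}"
    "\<psi> = (\<lambda>x. \<Sum>i\<in>V. of_bool (x i = p' i) - of_bool (x i = q' i))"
    using diff_queriesE[OF assms(2)] .
  define P Q where "P i = (if i \<in> U then p i else p' i)" and "Q i = (if i \<in> U then q i else q' i)" for i
  have "range P \<subseteq> {1..k}" "range Q \<subseteq> {1..k}"
    using 1 2 unfolding P_def Q_def image_subset_iff by auto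
  moreover have "(\<Sum>i\<in>U \<union> V. of_bool (x i = P i) - of_bool (x i = Q i)) = \<phi> x + \<psi> x" for x
  proof -
    have "(\<Sum>i\<in>V. of_bool (x i = P i) - of_bool (x i = Q i)) = \<psi> x"
      unfolding 2(3) P_def Q_def using assms(5) by (intro sum.cong) auto
    moreover have "(\<Sum>i\<in>U. of_bool (x i = P i) - of_bool (x i = Q i)) = \<phi> x"
      unfolding 1(3) P_def Q_def by (intro sum.cong) auto
    ultimately show ?thesis by (simp add: sum.union_disjoint[OF assms(3-5)])
  qed
  ultimately show ?thesis
    using diff_queriesI[of P k Q "U \<union> V"] by simp
qed

lemma diff_queries_mono:
  assumes "k \<ge> 1" "\<phi> \<in> diff_queries k U" "U \<subseteq> V" "finite V"
  shows "\<phi> \<in> diff_queries k V"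
proof -
  have "(\<lambda>x. \<phi> x + 0) \<in> diff_queries k (U \<union> (V - U))"
    using assms by (intro diff_queries_add diff_queries_zero) (auto intro: finite_subset)
  moreover have "U \<union> (V - U) = V" using assms by blast
  ultimately show ?thesis by simp
qed

lemma diff_queries_signed_sum:
  assumes "k \<ge> 1" "finite I" "\<And>i. i \<in> I \<Longrightarrow> A i \<in> diff_queries k (U i)"
    "\<And>i. i \<in> I \<Longrightarrow> finite (U i)" "disjoint_family_on U I"
    "\<And>i. i \<in> I \<Longrightarrow> s i = 1 \<or> s i = -1"
  shows "(\<lambda>x. \<Sum>i\<in>I. s i * A i x) \<in> diff_queries k (\<Union>i\<in>I. U i)"
  using assms(2-)
proof (induction I rule: finite_induct)
  case empty
  then show ?case using diff_queries_zero[OF assms(1)] by simp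
next
  case (insert j I)
  have "(\<lambda>x. s j * A j x) \<in> diff_queries k (U j)"
    using insert.prems(4)[of j] insert.prems(1)[of j] diff_queries_uminus[of "A j" k "U j"] by auto
  moreover have "(\<lambda>x. \<Sum>i\<in>I. s i * A i x) \<in> diff_queries k (\<Union>i\<in>I. U i)"
    using insert by (intro insert.IH) (auto simp: disjoint_family_on_def)
  moreover have "U j \<inter> (\<Union>i\<in>I. U i) = {}"
    using insert by (auto simp: disjoint_family_on_def)
  ultimately have "(\<lambda>x. s j * A j x + (\<Sum>i\<in>I. s i * A i x)) \<in> diff_queries k (U j \<union> (\<Union>i\<in>I. U i))"
    using insert by (intro diff_queries_add) auto
  then show ?case using insert by simp
qed

lemma diff_queries_bounded:
  assumes "\<phi> \<in> diff_queries k U"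
  shows "\<bar>\<phi> x\<bar> \<le> int (card U)"
proof -
  obtain p q where 1: "\<phi> = (\<lambda>x. \<Sum>i\<in>U. of_bool (x i = p i) - of_bool (x i = q i))"
    using diff_queriesE[OF assms] .
  have "\<bar>\<phi> x\<bar> \<le> (\<Sum>i\<in>U. \<bar>of_bool (x i = p i) - of_bool (x i = q i)\<bar>)"
    unfolding 1 by (rule sum_abs)
  also have "\<dots> \<le> (\<Sum>i\<in>U. 1)" by (intro sum_mono) auto
  finally show ?thesis by simp
qed

text \<open>
  Knowledge is represented by the set of remaining candidates, a goal by a predicate on such sets.
  The bound \<open>D\<close> limits the range of every answer on the current candidates; \<open>\<infinity>\<close> means no limit.
\<close>

primrec learn :: "nat \<Rightarrow> enat \<Rightarrow> nat \<Rightarrow> nat set \<Rightarrow> code set \<Rightarrow> (code set \<Rightarrow> bool) \<Rightarrow> bool" where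
  "learn k D 0 U X G = G X"
| "learn k D (Suc t) U X G = (\<exists>\<phi>\<in>diff_queries k U.
     (\<forall>x\<in>X. \<forall>y\<in>X. enat (nat (\<phi> x - \<phi> y)) \<le> D) \<and> (\<forall>a. learn k D t U {x \<in> X. \<phi> x = a} G))"

lemma learn_SucI:
  assumes "\<phi> \<in> diff_queries k U" "\<And>x y. x \<in> X \<Longrightarrow> y \<in> X \<Longrightarrow> enat (nat (\<phi> x - \<phi> y)) \<le> D"
    "\<And>a. learn k D t U {x \<in> X. \<phi> x = a} G"
  shows "learn k D (Suc t) U X G"
  using assms by auto

lemma learn_SucE:
  assumes "learn k D (Suc t) U X G"
  obtains \<phi> where "\<phi> \<in> diff_queries k U" "\<And>x y. x \<in> X \<Longrightarrow> y \<in> X \<Longrightarrow> enat (nat (\<phi> x - \<phi> y)) \<le> D"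
    "\<And>a. learn k D t U {x \<in> X. \<phi> x = a} G"
  using assms by auto

lemma learn_subset:
  assumes "learn k D t U X G" "Y \<subseteq> X" "hereditary G"
  shows "learn k D t U Y G"
  using assms(1,2)
proof (induction t arbitrary: X Y)
  case 0
  then show ?case using assms(3) by (auto dest: hereditaryD)
next
  case (Suc t)
  obtain \<phi> where *: "\<phi> \<in> diff_queries k U" "\<And>x y. x \<in> X \<Longrightarrow> y \<in> X \<Longrightarrow> enat (nat (\<phi> x - \<phi> y)) \<le> D"
    "\<And>a. learn k D t U {x \<in> X. \<phi> x = a} G"
    using learn_SucE[OF Suc.prems(1)] by blast
  have "learn k D t U {x \<in> Y. \<phi> x = a} G" for a
    using Suc.prems by (intro Suc.IH[OF *(3)[of a]]) auto
  then show ?case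
    using Suc.prems(2) by (intro learn_SucI[OF *(1)]) (auto intro!: *(2))
qed

lemma hereditary_learn: "hereditary G \<Longrightarrow> hereditary (\<lambda>Z. learn k D t U Z G)"
  by (intro hereditaryI) (rule learn_subset)

text \<open>The goals are compared only on subsets of \<open>X\<close>, so that facts about the
  present candidates may be used in the implication.\<close>

lemma learn_weaken:
  assumes "learn k D t U X G" "D \<le> D'" "U \<subseteq> U'" "finite U'" "k \<ge> 1"
    and "\<And>Z. Z \<subseteq> X \<Longrightarrow> G Z \<Longrightarrow> G' Z"
  shows "learn k D' t U' X G'"
  using assms(1,6)
proof (induction t arbitrary: X)
  case (Suc t)
  obtain \<phi> where *: "\<phi> \<in> diff_queries k U" "\<And>x y. x \<in> X \<Longrightarrow> y \<in> X \<Longrightarrow> enat (nat (\<phi> x - \<phi> y)) \<le> D"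
    "\<And>a. learn k D t U {x \<in> X. \<phi> x = a} G"
    using learn_SucE[OF Suc.prems(1)] by blast
  have "learn k D' t U' {x \<in> X. \<phi> x = a} G'" for a
    using Suc.prems by (intro Suc.IH[OF *(3)[of a]]) auto
  moreover have "\<phi> \<in> diff_queries k U'" using diff_queries_mono[OF assms(5) *(1) assms(3,4)] .
  ultimately show ?case
    using *(2) assms(2) by (intro learn_SucI[of \<phi>]) (auto intro: order_trans)
qed auto

lemma learn_Suc:
  assumes "learn k D t U X G" "hereditary G" "k \<ge> 1"
  shows "learn k D (Suc t) U X G"
proof -
  have "learn k D t U {x \<in> X. 0 = a} G" for a :: int
    by (rule learn_subset[OF assms(1) _ assms(2)]) auto
  then show ?thesis
    using diff_queries_zero[OF assms(3), of U]
    by (simp only: learn.simps) (intro bexI[of _ "\<lambda>_. 0"] conjI, auto simp: enat_0)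
qed

lemma learn_mono_time:
  assumes "learn k D t U X G" "t \<le> t'" "hereditary G" "k \<ge> 1"
  shows "learn k D t' U X G"
  using assms(2,1)
  by (induction rule: dec_induct) (use learn_Suc assms(3,4) in blast)+

text \<open>The continuation may depend on the candidates \<open>Z\<close> that are left. The
  intermediate goal \<open>F\<close> may itself say that something can be learned later;
  preparations are expressed in this way.\<close>

lemma learn_seq:
  assumes "learn k D s U X F" "\<And>Z. Z \<subseteq> X \<Longrightarrow> F Z \<Longrightarrow> learn k D t U Z G"
  shows "learn k D (s + t) U X G"
  using assms
proof (induction s arbitrary: X)
  case (Suc s)
  obtain \<phi> where *: "\<phi> \<in> diff_queries k U" "\<And>x y. x \<in> X \<Longrightarrow> y \<in> X \<Longrightarrow> enat (nat (\<phi> x - \<phi> y)) \<le> D"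
    "\<And>a. learn k D s U {x \<in> X. \<phi> x = a} F"
    using learn_SucE[OF Suc.prems(1)] by blast
  have "learn k D (s + t) U {x \<in> X. \<phi> x = a} G" for a
    using Suc.prems by (intro Suc.IH[OF *(3)[of a]]) auto
  then show ?case unfolding add_Suc using * by (intro learn_SucI[of \<phi>]) auto
qed auto

lemma learn_all:
  assumes "finite I" "\<And>i. i \<in> I \<Longrightarrow> learn k D t U X (G i)" "\<And>i. i \<in> I \<Longrightarrow> hereditary (G i)"
  shows "learn k D (card I * t) U X (\<lambda>Z. \<forall>i\<in>I. G i Z)"
  using assms
proof (induction I rule: finite_induct)
  case (insert j I)
  have "learn k D (card I * t) U X (\<lambda>Z. \<forall>i\<in>I. G i Z)"
    using insert by (intro insert.IH) auto
  moreover have "learn k D t U Z (\<lambda>Z. \<forall>i\<in>insert j I. G i Z)"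
    if Z: "Z \<subseteq> X" "\<forall>i\<in>I. G i Z" for Z
  proof -
    have "learn k D (t + 0) U Z (\<lambda>Z. \<forall>i\<in>insert j I. G i Z)"
    proof (rule learn_seq)
      show "learn k D t U Z (G j)"
        using learn_subset[OF insert.prems(1)[of j] Z(1)] insert.prems(2) by auto
      show "learn k D 0 U Y (\<lambda>Z. \<forall>i\<in>insert j I. G i Z)" if "Y \<subseteq> Z" "G j Y" for Y
        using that Z(2) insert.prems(2) by (auto dest: hereditaryD)
    qed
    then show ?thesis by simp
  qed
  ultimately have "learn k D (card I * t + t) U X (\<lambda>Z. \<forall>i\<in>insert j I. G i Z)"
    by (rule learn_seq)
  then show ?case using insert by (simp add: add.commute)
qed auto

section \<open>Signed sums over subsets\<close>

lemma sum_sign_Pow: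
  assumes "finite R"
  shows "(\<Sum>Q\<in>Pow R. (-1) ^ card (Q \<inter> i)) = (if R \<inter> i = {} then 2 ^ card R else 0 :: int)"
  using assms
proof (induction R rule: finite_induct)
  case (insert a R)
  have fin: "finite (Q \<inter> i)" if "Q \<in> Pow R" for Q
    using that insert(1) by (auto intro: finite_subset)
  have "(\<Sum>Q\<in>insert a ` Pow R. (-1) ^ card (Q \<inter> i)) = (\<Sum>Q\<in>Pow R. (-1) ^ card (insert a Q \<inter> i) :: int)"
    using insert(2) by (subst sum.reindex) (auto simp: inj_on_def)
  also have "\<dots> = (\<Sum>Q\<in>Pow R. (if a \<in> i then -1 else 1) * (-1) ^ card (Q \<inter> i))"
  proof (intro sum.cong refl)
    fix Q assume Q: "Q \<in> Pow R"
    then have "a \<notin> Q" using insert(2) by auto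
    then show "(-1) ^ card (insert a Q \<inter> i) = (if a \<in> i then -1 else 1) * (-1 :: int) ^ card (Q \<inter> i)"
      using fin[OF Q] by (cases "a \<in> i") auto
  qed
  also have "\<dots> = (if a \<in> i then -1 else 1) * (\<Sum>Q\<in>Pow R. (-1) ^ card (Q \<inter> i))"
    by (simp add: sum_distrib_left)
  finally have "(\<Sum>Q\<in>insert a ` Pow R. (-1) ^ card (Q \<inter> i))
      = (if a \<in> i then -1 else 1) * (\<Sum>Q\<in>Pow R. (-1 :: int) ^ card (Q \<inter> i))" .
  moreover have "Pow R \<inter> insert a ` Pow R = {}" using insert(2) by auto
  \<comment> \<open>Inserting \<open>a\<close> into \<open>Q\<close> flips the sign exactly if
    \<open>a \<in> i\<close>; then the two halves of \<open>Pow (insert a R)\<close> cancel,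
    otherwise they double.\<close>
  ultimately have "(\<Sum>Q\<in>Pow (insert a R). (-1) ^ card (Q \<inter> i))
      = (1 + (if a \<in> i then -1 else 1)) * (\<Sum>Q\<in>Pow R. (-1 :: int) ^ card (Q \<inter> i))"
    unfolding Pow_insert using insert(1)
    by (subst sum.union_disjoint) (auto simp: algebra_simps)
  then show ?case using insert by auto
qed auto

text \<open>Used to decode a carried answer from its residue. As \<open>nat\<close> sends negative
  differences to 0, bounding both orders bounds the absolute value.\<close>

lemma int_eq_of_dvd_diff:
  assumes "(2::int) ^ r dvd a - b" "nat (a - b) < 2 ^ r" "nat (b - a) < 2 ^ r"
  shows "a = b"
proof -
  have "a - b < 2 ^ r" "b - a < 2 ^ r"
    using assms(2,3) nat_less_iff[of "a - b" "2 ^ r"] nat_less_iff[of "b - a" "2 ^ r"]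
    by (cases "a \<le> b"; force simp: not_le)+
  then have "\<bar>a - b\<bar> < 2 ^ r" by linarith
  then show ?thesis
    using zdvd_not_zless[of "\<bar>a - b\<bar>" "2 ^ r"] assms(1) by fastforce
qed

section \<open>Free questions\<close>

text \<open>The rows of the Sylvester-Hadamard matrix of order \<open>2 ^ card N\<close>, with rows
  and columns indexed by the subsets of \<open>N\<close>.\<close>

definition sign_row :: "nat set \<Rightarrow> (nat set \<Rightarrow> code \<Rightarrow> int) \<Rightarrow> nat set \<Rightarrow> code \<Rightarrow> int" where
  "sign_row N A R x = (\<Sum>i\<in>Pow N. (-1) ^ card (R \<inter> i) * A i x)"

text \<open>After exchanging the sums only the \<open>i\<close> disjoint from \<open>R\<close>
  survive. Hence row \<open>R\<close> is known modulo \<open>2 ^ card R\<close> as soon as the rows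
  of all proper subsets of \<open>R\<close> are known.\<close>

lemma sum_sign_row_Pow:
  assumes "finite N" "R \<subseteq> N"
  shows "(\<Sum>Q\<in>Pow R. sign_row N A Q x) = 2 ^ card R * (\<Sum>i | i \<in> Pow N \<and> R \<inter> i = {}. A i x)"
proof -
  have "(\<Sum>Q\<in>Pow R. sign_row N A Q x) = (\<Sum>i\<in>Pow N. \<Sum>Q\<in>Pow R. (-1) ^ card (Q \<inter> i) * A i x)"
    unfolding sign_row_def by (rule sum.swap)
  also have "\<dots> = (\<Sum>i\<in>Pow N. if R \<inter> i = {} then 2 ^ card R * A i x else 0)"
    using sum_sign_Pow[OF finite_subset[OF assms(2,1)]]
    by (intro sum.cong refl) (simp add: sum_distrib_right[symmetric])
  also have "\<dots> = (\<Sum>i | i \<in> Pow N \<and> R \<inter> i = {}. 2 ^ card R * A i x)"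
    using assms(1) by (subst sum.inter_filter[symmetric]) auto
  finally show ?thesis by (simp add: sum_distrib_left)
qed

text \<open>Orthogonality of the Hadamard matrix: the signs of \<open>i\<close> and \<open>j\<close>
  multiply to that of their symmetric difference, and the sum over \<open>Pow N\<close> vanishes
  unless \<open>i = j\<close>.\<close>

lemma row_inversion:
  assumes "finite N" "j \<in> Pow N"
  shows "(\<Sum>R\<in>Pow N. (-1) ^ card (R \<inter> j) * sign_row N A R x) = 2 ^ card N * A j x"
proof -
  have sign: "(-1 :: int) ^ card (R \<inter> j) * (-1) ^ card (R \<inter> i) = (-1) ^ card (R \<inter> sym_diff i j)"
    if "R \<in> Pow N" for R i
  proof -
    have fin: "finite R" using that assms(1) by (auto intro: finite_subset)
    have "card (R \<inter> j) = card (R \<inter> (j - i)) + card (R \<inter> (i \<inter> j))"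
      using fin by (subst card_Un_disjoint[symmetric]) (auto intro!: arg_cong[of _ _ card])
    moreover have "card (R \<inter> i) = card (R \<inter> (i - j)) + card (R \<inter> (i \<inter> j))"
      using fin by (subst card_Un_disjoint[symmetric]) (auto intro!: arg_cong[of _ _ card])
    moreover have "card (R \<inter> sym_diff i j) = card (R \<inter> (i - j)) + card (R \<inter> (j - i))"
      using fin by (subst card_Un_disjoint[symmetric]) (auto intro!: arg_cong[of _ _ card])
    ultimately show ?thesis by (simp add: power_add)
  qed
  have "(\<Sum>R\<in>Pow N. (-1) ^ card (R \<inter> j) * sign_row N A R x)
      = (\<Sum>R\<in>Pow N. \<Sum>i\<in>Pow N. (-1) ^ card (R \<inter> sym_diff i j) * A i x)"
    unfolding sign_row_def sum_distrib_left
    by (intro sum.cong refl) (simp add: sign mult.assoc[symmetric])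
  also have "\<dots> = (\<Sum>i\<in>Pow N. \<Sum>R\<in>Pow N. (-1) ^ card (R \<inter> sym_diff i j) * A i x)"
    by (rule sum.swap)
  also have "\<dots> = (\<Sum>i\<in>Pow N. if N \<inter> sym_diff i j = {} then 2 ^ card N * A i x else 0)"
    using sum_sign_Pow[OF assms(1)]
    by (intro sum.cong refl) (simp add: sum_distrib_right[symmetric])
  also have "\<dots> = (\<Sum>i\<in>Pow N. if i = j then 2 ^ card N * A i x else 0)"
    using assms(2) by (intro sum.cong refl if_cong) auto
  also have "\<dots> = 2 ^ card N * A j x" using assms by simp
  finally show ?thesis .
qed

lemma constant_on_rows:
  assumes "finite N" "\<And>R. R \<in> Pow N \<Longrightarrow> sign_row N A R constant_on Z" "i \<in> Pow N"
  shows "A i constant_on Z"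
proof (rule constant_onI)
  fix x y assume xy: "x \<in> Z" "y \<in> Z"
  have "2 ^ card N * A i x = 2 ^ card N * A i y"
    unfolding row_inversion[OF assms(1,3), symmetric]
    using constant_onD[OF assms(2) xy] by (intro sum.cong refl) auto
  then show "A i x = A i y" by simp
qed

text \<open>One batch: each row is asked once, smaller \<open>R\<close> first. \<open>\<R>\<close>
  holds the rows still to be asked, and each of them with \<open>d < 2 ^ card R\<close> carries one
  question of the search for \<open>H\<close>; \<open>w\<close> is what remains of that search
  afterwards. When no row is left, all \<open>A i\<close> are known and \<open>cont\<close> takes
  over.\<close>

lemma learn_rows:
  fixes d :: nat
  assumes k: "k \<ge> 1" and N: "finite N"
    and A: "\<And>i. i \<in> Pow N \<Longrightarrow> A i \<in> diff_queries k (U i)"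
    and U: "\<And>i. i \<in> Pow N \<Longrightarrow> finite (U i)" "disjoint_family_on U (Pow N)"
    and V: "finite V" "\<And>i. i \<in> Pow N \<Longrightarrow> U i \<inter> V = {}"
    and H: "hereditary H"
    and cont: "\<And>Z. Z \<subseteq> Y \<Longrightarrow> (\<And>i. i \<in> Pow N \<Longrightarrow> A i constant_on Z) \<Longrightarrow> learn k d w V Z H \<Longrightarrow>
      learn k \<infinity> t ((\<Union>i\<in>Pow N. U i) \<union> V) Z K"
    and "\<R> \<subseteq> Pow N" "\<And>R. R \<in> Pow N - \<R> \<Longrightarrow> sign_row N A R constant_on Y"
    and "learn k d (w + card {R \<in> \<R>. d < 2 ^ card R}) V Y H"
  shows "learn k \<infinity> (card \<R> + t) ((\<Union>i\<in>Pow N. U i) \<union> V) Y K"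
  using cont \<open>\<R> \<subseteq> Pow N\<close> assms(11-)
proof (induction "card \<R>" arbitrary: \<R> Y)
  case 0
  then have "\<R> = {}" using N by (auto dest: finite_subset)
  then show ?case using 0 constant_on_rows[OF N] by simp
next
  case (Suc s)
  note cont = Suc.prems(1)
  have fin: "finite \<R>" using Suc.prems(2) N by (auto intro: finite_subset)
  have "\<R> \<noteq> {}" using Suc.hyps(2) by auto
  \<comment> \<open>Minimal cardinality ensures that the rows of all proper subsets of
    \<open>R\<close> are already known.\<close>
  then obtain R where R: "R \<in> \<R>" "\<And>Q. Q \<in> \<R> \<Longrightarrow> card R \<le> card Q"
    using ex_has_least_nat[of "\<lambda>R. R \<in> \<R>" _ card] by auto
  have RN: "R \<subseteq> N" using R(1) Suc.prems(2) by auto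
  have card: "s = card (\<R> - {R})" using Suc.hyps(2) R(1) fin by simp
  have const: "sign_row N A Q constant_on Y" if "Q \<subset> R" for Q
  proof (rule Suc.prems(3))
    have "card Q < card R" using that RN N by (meson finite_subset psubset_card_mono)
    then show "Q \<in> Pow N - \<R>" using R(2)[of Q] that RN by fastforce
  qed
  have row: "sign_row N A R \<in> diff_queries k (\<Union>i\<in>Pow N. U i)"
    unfolding sign_row_def using k N A U
    by (intro diff_queries_signed_sum) (auto simp: minus_one_power_iff)
  have rest: "learn k \<infinity> (s + t) ((\<Union>i\<in>Pow N. U i) \<union> V) Z K"
    if "Z \<subseteq> Y" "sign_row N A R constant_on Z" "learn k d (w + card {Q \<in> \<R> - {R}. d < 2 ^ card Q}) V Z H" for Z
    unfolding card
  proof (rule Suc.hyps(1)[OF card])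
    show "sign_row N A Q constant_on Z" if "Q \<in> Pow N - (\<R> - {R})" for Q
      using that \<open>Z \<subseteq> Y\<close> \<open>sign_row N A R constant_on Z\<close> Suc.prems(3)[of Q]
      by (cases "Q = R") (auto intro: hereditaryD[OF hereditary_constant_on])
  qed (use that cont Suc.prems(2) in auto)
  show ?case
  proof (cases "d < 2 ^ card R")
    \<comment> \<open>The modulus \<open>2 ^ card R\<close> is too small for decoding, so the row is
      asked alone.\<close>
    case False
    then have eq: "{Q \<in> \<R> - {R}. d < 2 ^ card Q} = {Q \<in> \<R>. d < 2 ^ card Q}" by auto
    have chain: "learn k d (w + card {Q \<in> \<R> - {R}. d < 2 ^ card Q}) V Y H"
      using Suc.prems(4) by (simp only: eq)
    have "learn k \<infinity> (Suc (s + t)) ((\<Union>i\<in>Pow N. U i) \<union> V) Y K"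
    proof (rule learn_SucI)
      show "sign_row N A R \<in> diff_queries k ((\<Union>i\<in>Pow N. U i) \<union> V)"
        using diff_queries_mono[OF k row] N U V by auto
      show "learn k \<infinity> (s + t) ((\<Union>i\<in>Pow N. U i) \<union> V) {x \<in> Y. sign_row N A R x = a} K" for a
        by (intro rest learn_subset[OF chain _ H]) (auto simp: constant_on_def)
    qed auto
    then show ?thesis unfolding Suc.hyps(2)[symmetric] add_Suc .
  next
    case True
    have "{Q \<in> \<R>. d < 2 ^ card Q} = insert R {Q \<in> \<R> - {R}. d < 2 ^ card Q}"
      using R(1) True by auto
    then have "card {Q \<in> \<R>. d < 2 ^ card Q} = Suc (card {Q \<in> \<R> - {R}. d < 2 ^ card Q})"
      using fin by simp
    then have "learn k d (Suc (w + card {Q \<in> \<R> - {R}. d < 2 ^ card Q})) V Y H"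
      using Suc.prems(4) by simp
    then obtain e where e: "e \<in> diff_queries k V"
      "\<And>x y. x \<in> Y \<Longrightarrow> y \<in> Y \<Longrightarrow> enat (nat (e x - e y)) \<le> d"
      "\<And>a. learn k d (w + card {Q \<in> \<R> - {R}. d < 2 ^ card Q}) V {x \<in> Y. e x = a} H"
      using learn_SucE by blast
    have "learn k \<infinity> (Suc (s + t)) ((\<Union>i\<in>Pow N. U i) \<union> V) Y K"
    proof (rule learn_SucI)
      show "(\<lambda>x. sign_row N A R x + e x) \<in> diff_queries k ((\<Union>i\<in>Pow N. U i) \<union> V)"
        using row e(1) N U V by (intro diff_queries_add) auto
      fix a
      define Z where "Z = {x \<in> Y. sign_row N A R x + e x = a}"
      have e_eq: "e x = e y" if xy: "x \<in> Z" "y \<in> Z" for x y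
      proof -
        have Y: "x \<in> Y" "y \<in> Y" and eq: "sign_row N A R x + e x = sign_row N A R y + e y"
          using xy by (auto simp: Z_def)
        \<comment> \<open>On \<open>Z\<close> the row and the carried question have a constant sum,
          and the rows of proper subsets of \<open>R\<close> are constant. So two carried answers
          differ by a multiple of \<open>2 ^ card R\<close>, and the range \<open>d\<close> makes
          them equal.\<close>
        have split: "(\<Sum>Q\<in>Pow R. sign_row N A Q z) = sign_row N A R z + (\<Sum>Q\<in>Pow R - {R}. sign_row N A Q z)" for z
          using finite_subset[OF RN N] by (intro sum.remove) auto
        have "(\<Sum>Q\<in>Pow R - {R}. sign_row N A Q x) = (\<Sum>Q\<in>Pow R - {R}. sign_row N A Q y)"
          by (intro sum.cong refl constant_onD[OF const] Y) auto
        then have "e x - e y = (\<Sum>Q\<in>Pow R. sign_row N A Q y) - (\<Sum>Q\<in>Pow R. sign_row N A Q x)"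
          using eq split by simp
        then have dvd: "2 ^ card R dvd e x - e y"
          unfolding sum_sign_row_Pow[OF N RN] by (simp add: right_diff_distrib[symmetric])
        have "nat (e x - e y) \<le> d" "nat (e y - e x) \<le> d"
          using e(2)[OF Y] e(2)[OF Y(2,1)] by simp_all
        then show ?thesis
          using True by (intro int_eq_of_dvd_diff[OF dvd]) (rule le_less_trans; assumption)+
      qed
      have "e constant_on Z" using e_eq by (rule constant_onI)
      then obtain b where b: "\<And>x. x \<in> Z \<Longrightarrow> e x = b" unfolding constant_on_def by auto
      show "learn k \<infinity> (s + t) ((\<Union>i\<in>Pow N. U i) \<union> V) {x \<in> Y. sign_row N A R x + e x = a} K"
        unfolding Z_def[symmetric]
      proof (rule rest)
        show "sign_row N A R constant_on Z"
        proof (rule constant_onI)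
          fix x y assume "x \<in> Z" "y \<in> Z"
          then show "sign_row N A R x = sign_row N A R y" using e_eq[of x y] by (simp add: Z_def)
        qed
        show "learn k d (w + card {Q \<in> \<R> - {R}. d < 2 ^ card Q}) V Z H"
          using b by (intro learn_subset[OF e(3)[of b] _ H]) (auto simp: Z_def)
      qed (auto simp: Z_def)
    qed auto
    then show ?thesis unfolding Suc.hyps(2)[symmetric] add_Suc .
  qed
qed

lemma pred_less_iff_le: "(a :: nat) > 0 \<Longrightarrow> a - 1 < b \<longleftrightarrow> a \<le> b"
  by linarith

text \<open>Complementation in a set of odd size exchanges the subsets with more than
  \<open>j\<close> elements and the others, so exactly half of the rows can carry a question of
  range \<open>2 ^ (j + 1) - 1\<close>.\<close>

lemma card_large_subsets:
  assumes "finite N" "card N = 2 * j + 1"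
  shows "card {R \<in> Pow N. 2 ^ (j + 1) - 1 < (2::nat) ^ card R} = 2 ^ (2 * j)"
proof -
  have eq: "2 ^ (j + 1) - 1 < (2::nat) ^ card R \<longleftrightarrow> j < card R" for R :: "'a set"
  proof -
    have "2 ^ (j + 1) - 1 < (2::nat) ^ card R \<longleftrightarrow> (2::nat) ^ (j + 1) \<le> 2 ^ card R"
      by (rule pred_less_iff_le) simp
    then show ?thesis by (simp add: Suc_le_eq del: power_Suc)
  qed
  have "bij_betw (\<lambda>R. N - R) {R \<in> Pow N. j < card R} {R \<in> Pow N. \<not> j < card R}"
    by (rule bij_betw_byWitness[where f' = "\<lambda>R. N - R"])
      (use assms in \<open>auto simp: card_Diff_subset finite_subset double_diff\<close>)
  then have "card {R \<in> Pow N. j < card R} = card {R \<in> Pow N. \<not> j < card R}"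
    by (rule bij_betw_same_card)
  moreover have "card {R \<in> Pow N. j < card R} + card {R \<in> Pow N. \<not> j < card R} = card (Pow N)"
    using assms(1) by (subst card_Un_disjoint[symmetric]) (auto intro!: arg_cong[of _ _ card])
  ultimately show ?thesis
    using assms unfolding eq by (simp add: card_Pow)
qed

text \<open>Each of the \<open>t\<close> rounds asks one batch of \<open>2 ^ (2 * j + 1)\<close>
  rows: every search advances by one query, and the search for \<open>H\<close> by
  \<open>2 ^ (2 * j)\<close> questions.\<close>

lemma learn_parallel_Pow:
  fixes N :: "nat set"
  assumes k: "k \<ge> 1" and N: "finite N" "card N = 2 * j + 1"
    and U: "\<And>i. i \<in> Pow N \<Longrightarrow> finite (U i)" "disjoint_family_on U (Pow N)"
    and V: "finite V" "\<And>i. i \<in> Pow N \<Longrightarrow> U i \<inter> V = {}"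
    and G: "\<And>i. i \<in> Pow N \<Longrightarrow> hereditary (G i)" and H: "hereditary H"
    and "\<And>i. i \<in> Pow N \<Longrightarrow> learn k \<infinity> t (U i) Y (G i)"
    and "learn k (2 ^ (j + 1) - 1 :: nat) (t * 2 ^ (2 * j)) V Y H"
  shows "learn k \<infinity> (t * 2 ^ (2 * j + 1)) ((\<Union>i\<in>Pow N. U i) \<union> V) Y (\<lambda>Z. (\<forall>i\<in>Pow N. G i Z) \<and> H Z)"
  using assms(10-)
proof (induction t arbitrary: Y)
  case (Suc t)
  have "\<forall>i. \<exists>\<phi>. i \<in> Pow N \<longrightarrow> \<phi> \<in> diff_queries k (U i) \<and> (\<forall>a. learn k \<infinity> t (U i) {x \<in> Y. \<phi> x = a} (G i))"
    using learn_SucE[OF Suc.prems(1)] by metis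
  then obtain A where A: "\<And>i. i \<in> Pow N \<Longrightarrow> A i \<in> diff_queries k (U i)"
    "\<And>i a. i \<in> Pow N \<Longrightarrow> learn k \<infinity> t (U i) {x \<in> Y. A i x = a} (G i)" by metis
  have "learn k \<infinity> (card (Pow N) + t * 2 ^ (2 * j + 1)) ((\<Union>i\<in>Pow N. U i) \<union> V) Y
      (\<lambda>Z. (\<forall>i\<in>Pow N. G i Z) \<and> H Z)"
  proof (rule learn_rows[where A = A and w = "t * 2 ^ (2 * j)" and d = "2 ^ (j + 1) - 1" and H = H])
    show "learn k (2 ^ (j + 1) - 1 :: nat)
        (t * 2 ^ (2 * j) + card {R \<in> Pow N. 2 ^ (j + 1) - 1 < (2::nat) ^ card R}) V Y H"
      using Suc.prems(2) unfolding card_large_subsets[OF N] by (simp add: add.commute)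
    fix Z assume Z: "Z \<subseteq> Y" "\<And>i. i \<in> Pow N \<Longrightarrow> A i constant_on Z"
      "learn k (2 ^ (j + 1) - 1 :: nat) (t * 2 ^ (2 * j)) V Z H"
    show "learn k \<infinity> (t * 2 ^ (2 * j + 1)) ((\<Union>i\<in>Pow N. U i) \<union> V) Z (\<lambda>Z. (\<forall>i\<in>Pow N. G i Z) \<and> H Z)"
    proof (rule Suc.IH[OF _ Z(3)])
      fix i assume i: "i \<in> Pow N"
      obtain a where "\<And>x. x \<in> Z \<Longrightarrow> A i x = a" using Z(2)[OF i] unfolding constant_on_def by auto
      then show "learn k \<infinity> t (U i) Z (G i)"
        using Z(1) by (intro learn_subset[OF A(2)[OF i, of a] _ G[OF i]]) auto
    qed
  qed (use k N U V H A in auto)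
  then show ?case using N by (simp add: card_Pow algebra_simps)
qed auto

lemma learn_parallel:
  assumes k: "k \<ge> 1" and I: "finite I" "card I = 2 ^ (2 * j + 1)"
    and U: "\<And>i. i \<in> I \<Longrightarrow> finite (U i)" "disjoint_family_on U I"
    and V: "finite V" "\<And>i. i \<in> I \<Longrightarrow> U i \<inter> V = {}"
    and G: "\<And>i. i \<in> I \<Longrightarrow> hereditary (G i)" and H: "hereditary H"
    and "\<And>i. i \<in> I \<Longrightarrow> learn k \<infinity> t (U i) Y (G i)"
    and "learn k (2 ^ (j + 1) - 1 :: nat) (t * 2 ^ (2 * j)) V Y H"
  shows "learn k \<infinity> (t * 2 ^ (2 * j + 1)) ((\<Union>i\<in>I. U i) \<union> V) Y (\<lambda>Z. (\<forall>i\<in>I. G i Z) \<and> H Z)"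
proof -
  define N where "N = {..<2 * j + 1}"
  have N: "finite N" "card N = 2 * j + 1" by (auto simp: N_def)
  obtain b where b: "bij_betw b (Pow N) I"
    using finite_same_card_bij[of "Pow N" I] I N by (auto simp: card_Pow)
  have img: "b ` Pow N = I" using b by (simp add: bij_betw_def)
  have mem: "b i \<in> I" if "i \<in> Pow N" for i using img that by blast
  have inj: "inj_on b (Pow N)" using b by (simp add: bij_betw_def)
  have "learn k \<infinity> (t * 2 ^ (2 * j + 1)) ((\<Union>i\<in>Pow N. U (b i)) \<union> V) Y
      (\<lambda>Z. (\<forall>i\<in>Pow N. G (b i) Z) \<and> H Z)"
  proof (rule learn_parallel_Pow[OF k N])
    show "disjoint_family_on (\<lambda>i. U (b i)) (Pow N)"
      using U(2) inj mem unfolding disjoint_family_on_def inj_on_def by blast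
  qed (use assms mem in auto)
  moreover have "(\<Union>i\<in>Pow N. U (b i)) = (\<Union>i\<in>I. U i)" unfolding img[symmetric] by blast
  moreover have "(\<forall>i\<in>Pow N. G (b i) Z) \<longleftrightarrow> (\<forall>i\<in>I. G i Z)" for Z unfolding img[symmetric] by blast
  ultimately show ?thesis by simp
qed

section \<open>Locating colours\<close>

definition hits :: "(nat \<times> nat) set \<Rightarrow> code \<Rightarrow> nat" where
  "hits T x = card {p \<in> T. x (fst p) = snd p}"

text \<open>
  A set of pairs (position, colour) stands for the possible facts \<open>x i = c\<close>. A token is such a set with
  a single colour and a known number of true facts.
\<close>

definition token :: "nat \<Rightarrow> code set \<Rightarrow> (nat \<times> nat) set \<Rightarrow> bool" where
  "token d Z T \<longleftrightarrow> (\<exists>c. snd ` T \<subseteq> {c}) \<and> hits T constant_on Z \<and>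
     (card T \<le> 1 \<or> (\<forall>x\<in>Z. hits T x \<le> d))"

text \<open>Round \<open>j\<close> lowers \<open>d\<close> from \<open>2 ^ (j + 1) - 1\<close> to
  \<open>2 ^ j - 1\<close>. A token with at most one cell is exempt from the bound, being settled by
  its hit count.\<close>

definition tokens :: "nat \<Rightarrow> code set \<Rightarrow> (nat \<times> nat) set \<Rightarrow> bool" where
  "tokens d Z W \<longleftrightarrow> (\<exists>P. finite P \<and> pairwise disjnt P \<and> \<Union>P = W \<and> (\<forall>T\<in>P. token d Z T))"

lemma hereditary_tokens: "hereditary (\<lambda>Z. tokens d Z W)"
proof (rule hereditaryI)
  fix X Y assume *: "tokens d X W" "Y \<subseteq> X"
  have "token d Y T" if "token d X T" for T
    using that *(2) hereditaryD[OF hereditary_constant_on _ *(2)] unfolding token_def by blast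
  then show "tokens d Y W" using * unfolding tokens_def by blast
qed

lemma tokens_empty: "tokens d Z {}"
  unfolding tokens_def by (rule exI[of _ "{}"]) auto

lemma tokens_Un:
  assumes "tokens d Z V" "tokens d Z W" "V \<inter> W = {}"
  shows "tokens d Z (V \<union> W)"
proof -
  obtain P Q where "finite P" "pairwise disjnt P" "\<Union>P = V" "\<forall>T\<in>P. token d Z T"
    "finite Q" "pairwise disjnt Q" "\<Union>Q = W" "\<forall>T\<in>Q. token d Z T"
    using assms unfolding tokens_def by metis
  then show ?thesis
    using assms(3) unfolding tokens_def
    by (intro exI[of _ "P \<union> Q"]) (auto simp: pairwise_def disjnt_def, blast+)
qed

lemma tokens_UN:
  assumes "finite I" "disjoint_family_on W I" "\<And>i. i \<in> I \<Longrightarrow> tokens d Z (W i)"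
  shows "tokens d Z (\<Union>i\<in>I. W i)"
  using assms
proof (induction I rule: finite_induct)
  case (insert i I)
  have "tokens d Z (W i \<union> (\<Union>i\<in>I. W i))"
    using insert by (intro tokens_Un insert.IH) (auto simp: disjoint_family_on_def)
  then show ?case by simp
qed (simp add: tokens_empty)

lemma hits_Un:
  assumes "finite S" "finite T" "S \<inter> T = {}"
  shows "hits (S \<union> T) x = hits S x + hits T x"
  unfolding hits_def using assms
  by (subst card_Un_disjoint[symmetric]) (auto intro!: arg_cong[of _ _ card])

lemma hits_Union:
  assumes "finite P" "pairwise disjnt P" "\<And>T. T \<in> P \<Longrightarrow> finite T"
  shows "hits (\<Union>P) x = (\<Sum>T\<in>P. hits T x)"
  using assms
proof (induction P rule: finite_induct)
  case empty
  then show ?case by (simp add: hits_def)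
next
  case (insert T P)
  have "T \<inter> \<Union>P = {}" using insert(2,4) by (auto simp: pairwise_insert disjnt_def)
  then show ?case
    using insert hits_Un[of T "\<Union>P" x] by (simp add: pairwise_insert)
qed

text \<open>A code has one colour at each position, so \<open>fst\<close> is injective on the true
  facts in \<open>W\<close>.\<close>

lemma hits_le_card:
  assumes "W \<subseteq> v \<times> UNIV" "finite v"
  shows "hits W x \<le> card v"
  unfolding hits_def
proof (rule card_inj_on_le[where f = fst])
  show "inj_on fst {p \<in> W. x (fst p) = snd p}" by (auto simp: inj_on_def)
qed (use assms in auto)

lemma hits_mono: "finite T \<Longrightarrow> S \<subseteq> T \<Longrightarrow> hits S x \<le> hits T x"
  unfolding hits_def by (rule card_mono) auto

lemma hits_le: "finite T \<Longrightarrow> hits T x \<le> card T"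
  unfolding hits_def by (rule card_mono) auto

text \<open>Such a colour is a silent filler for positions that a query should not count.\<close>

definition blank_colour :: "nat \<Rightarrow> code set \<Rightarrow> nat set \<Rightarrow> bool" where
  "blank_colour k Y v \<longleftrightarrow> (\<exists>c\<in>{1..k}. \<forall>x\<in>Y. \<forall>i\<in>v. x i \<noteq> c)"

lemma blank_colour_subset: "blank_colour k Y v \<Longrightarrow> Z \<subseteq> Y \<Longrightarrow> u \<subseteq> v \<Longrightarrow> blank_colour k Z u"
  unfolding blank_colour_def by blast

lemma finite_cells: "W \<subseteq> v \<times> {1..k} \<Longrightarrow> finite v \<Longrightarrow> finite W" for k :: nat
  by (rule finite_subset) auto

text \<open>The query \<open>p\<close> asks \<open>c\<close> on the cells of \<open>T\<close> and
  the filler elsewhere, the subtracted query is filler throughout. The difference is exactly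
  \<open>hits T\<close>, which lies between 0 and \<open>d\<close>.\<close>

lemma learn_hits:
  assumes v: "finite v" and T: "T \<subseteq> v \<times> {1..k}" "snd ` T \<subseteq> {c}"
    and Y: "blank_colour k Y v" and d: "\<And>x. x \<in> Y \<Longrightarrow> hits T x \<le> d"
  shows "learn k d 1 v Y (\<lambda>Z. hits T constant_on Z)"
proof -
  obtain b where b: "b \<in> {1..k}" "\<And>x i. x \<in> Y \<Longrightarrow> i \<in> v \<Longrightarrow> x i \<noteq> b"
    using Y unfolding blank_colour_def by blast
  define p where "p i = (if (i, c) \<in> T then c else b)" for i
  define \<phi> :: "code \<Rightarrow> int" where "\<phi> x = (\<Sum>i\<in>v. of_bool (x i = p i) - of_bool (x i = b))" for x
  have "range p \<subseteq> {1..k}" using b(1) T(1) by (auto simp: p_def)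
  then have \<phi>: "\<phi> \<in> diff_queries k v"
    unfolding \<phi>_def using b(1) by (intro diff_queriesI) auto
  have eq: "\<phi> x = int (hits T x)" if x: "x \<in> Y" for x
  proof -
    have "\<phi> x = (\<Sum>i\<in>v. of_bool ((i, c) \<in> T \<and> x i = c))"
      unfolding \<phi>_def p_def using b(2)[OF x] by (intro sum.cong) auto
    also have "\<dots> = int (card {i \<in> v. (i, c) \<in> T \<and> x i = c})"
      using v by (simp add: sum_of_bool_eq Collect_conj_eq)
    also have "card {i \<in> v. (i, c) \<in> T \<and> x i = c} = card {q \<in> T. x (fst q) = snd q}"
      by (rule bij_betw_same_card[of "\<lambda>i. (i, c)"], rule bij_betw_byWitness[where f' = fst])
        (use T in auto)
    finally show ?thesis by (simp add: hits_def)
  qed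
  have "learn k d (Suc 0) v Y (\<lambda>Z. hits T constant_on Z)"
  proof (rule learn_SucI[OF \<phi>])
    fix x y assume "x \<in> Y" "y \<in> Y"
    then show "enat (nat (\<phi> x - \<phi> y)) \<le> enat d" using eq[of x] eq[of y] d[of x] by simp
  next
    fix a
    have "int (hits T x) = a" if "x \<in> {x \<in> Y. \<phi> x = a}" for x using eq[of x] that by auto
    then show "learn k d 0 v {x \<in> Y. \<phi> x = a} (\<lambda>Z. hits T constant_on Z)"
      by (simp add: constant_on_def) (metis nat_int)
  qed
  then show ?thesis by simp
qed

text \<open>Bounds the number of tokens to be split in a region of at most
  \<open>2 ^ \<delta>\<close> positions, since each of them has at least \<open>2 ^ j\<close> hits.
  A single position needs no split: its tokens have at most one cell.\<close>

definition split_cost :: "nat \<Rightarrow> nat \<Rightarrow> nat" where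
  "split_cost j \<delta> = (if \<delta> = 0 then 0 else 2 ^ \<delta> div 2 ^ j)"

lemma card_monochrome:
  assumes "T \<subseteq> v \<times> UNIV" "finite v" "snd ` T \<subseteq> {c}"
  shows "card T \<le> card v"
proof (rule card_inj_on_le[where f = fst])
  have "snd p = c" if "p \<in> T" for p using assms(3) that by blast
  then show "inj_on fst T" by (metis inj_onI prod_eqI)
qed (use assms in auto)

text \<open>One question per token above the bound \<open>d\<close>, for its hits in
  \<open>l\<close>, suffices: the hits in \<open>r\<close> follow by subtraction from the known
  total. Tokens already within the bound are set aside in \<open>F\<close>.\<close>

lemma split_tokens:
  fixes j :: nat
  defines "D \<equiv> 2 ^ (j + 1) - 1" and "d \<equiv> 2 ^ j - 1"
  assumes k: "k \<ge> 1" and v: "finite v" "card v \<le> 2 ^ \<delta>" "l \<union> r = v" "l \<inter> r = {}"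
    and W: "W \<subseteq> v \<times> {1..k}" "tokens D Y W" and Y: "blank_colour k Y v"
  shows "learn k D (split_cost j \<delta>) v Y (\<lambda>Z. \<exists>F\<subseteq>W. tokens d Z F \<and>
    tokens D Z ((W - F) \<inter> l \<times> UNIV) \<and> tokens D Z ((W - F) \<inter> r \<times> UNIV))"
proof -
  obtain P where P: "finite P" "pairwise disjnt P" "\<Union>P = W" "\<And>T. T \<in> P \<Longrightarrow> token D Y T"
    using W(2) unfolding tokens_def by blast
  define A where "A = {T \<in> P. \<not> token d Y T}"
  define F where "F = \<Union>(P - A)"
  have sub: "T \<subseteq> v \<times> {1..k}" if "T \<in> P" for T using that P(3) W(1) by blast
  have fin: "finite T" if "T \<in> P" for T using finite_cells[OF sub[OF that] v(1)] .
  have AP: "A \<subseteq> P" "finite A" using P(1) by (auto simp: A_def)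
  have WF: "W - F = \<Union>A"
  proof -
    have "T \<inter> S = {}" if "T \<in> A" "S \<in> P - A" for T S
      using P(2) AP(1) that unfolding pairwise_def disjnt_def by (metis DiffD1 DiffD2 subsetD)
    then have "F \<inter> \<Union>A = {}" unfolding F_def by blast
    moreover have "F \<union> \<Union>A = W" unfolding F_def using P(3) AP(1) by blast
    ultimately show ?thesis by blast
  qed
  \<comment> \<open>\<open>D\<close> is at least 1, so the exempt single cells respect it as
    well.\<close>
  have "(2::nat) \<le> 2 ^ (j + 1)" by simp
  then have D1: "1 \<le> D" unfolding D_def by linarith
  have Dhits: "hits T x \<le> D" if T: "T \<in> P" and x: "x \<in> Y" for T x
  proof -
    consider "card T \<le> 1" | "\<forall>x\<in>Y. hits T x \<le> D" using P(4)[OF T] unfolding token_def by blast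
    then show ?thesis
    proof cases
      case 1
      then show ?thesis using hits_le[OF fin[OF T], of x] D1 by linarith
    qed (use x in blast)
  qed
  have big: "card T > 1 \<and> (\<exists>x\<in>Y. d < hits T x)" if "T \<in> A" for T
  proof -
    have T: "T \<in> P" "\<not> token d Y T" using that by (auto simp: A_def)
    have "\<not> (card T \<le> 1 \<or> (\<forall>x\<in>Y. hits T x \<le> d))"
      using T(2) P(4)[OF T(1)] unfolding token_def by blast
    then show ?thesis by (simp add: not_le)
  qed
  \<comment> \<open>The tokens in \<open>A\<close> are disjoint and have at least
    \<open>2 ^ j\<close> hits each, while a single candidate has at most \<open>card v\<close> hits
    in \<open>W\<close>.\<close>
  have A_cost: "card A \<le> split_cost j \<delta>"
  proof (cases "A = {}")
    case False
    then obtain T where "T \<in> A" by blast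
    then obtain x where x: "x \<in> Y" and "card T > 1" using big by blast
    have TP: "T \<in> P" using \<open>T \<in> A\<close> AP(1) by blast
    have "T \<subseteq> v \<times> UNIV" using sub[OF TP] by blast
    moreover obtain c where "snd ` T \<subseteq> {c}" using P(4)[OF TP] unfolding token_def by blast
    ultimately have "1 < card v"
      using card_monochrome[of T v c] v(1) \<open>card T > 1\<close> by linarith
    then have "\<delta> \<noteq> 0" using v(2) by (cases \<delta>) auto
    have ge: "2 ^ j \<le> hits T x" if T: "T \<in> A" for T
    proof -
      obtain y where "y \<in> Y" "d < hits T y" using big[OF T] by blast
      moreover have "hits T constant_on Y" using T AP P(4) unfolding token_def by blast
      ultimately show ?thesis using x constant_onD[of "hits T" Y x y] by (simp add: d_def)
    qed
    have "card A * 2 ^ j \<le> (\<Sum>T\<in>A. hits T x)"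
      using sum_bounded_below[of A "2 ^ j" "\<lambda>T. hits T x"] ge by simp
    also have "\<dots> \<le> (\<Sum>T\<in>P. hits T x)" using AP P(1) by (intro sum_mono2) auto
    also have "\<dots> = hits W x" using hits_Union[OF P(1,2) fin] P(3) by simp
    also have "\<dots> \<le> card v" using W(1) v(1) by (intro hits_le_card) auto
    finally have "card A * 2 ^ j \<le> 2 ^ \<delta>" using v(2) by linarith
    then show ?thesis using \<open>\<delta> \<noteq> 0\<close> by (simp add: split_cost_def less_eq_div_iff_mult_less_eq)
  qed simp
  define G where "G T Z \<longleftrightarrow> hits (T \<inter> l \<times> UNIV) constant_on Z" for T Z
  have "learn k D (card A * 1) v Y (\<lambda>Z. \<forall>T\<in>A. G T Z)"
  proof (rule learn_all[OF AP(2)])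
    show "hereditary (G T)" for T unfolding G_def by (rule hereditary_constant_on)
    fix T assume "T \<in> A"
    then have T: "T \<in> P" using AP by blast
    obtain c where c: "snd ` T \<subseteq> {c}" using P(4)[OF T] unfolding token_def by blast
    show "learn k D 1 v Y (G T)"
      unfolding G_def
    proof (rule learn_hits[OF v(1) _ _ Y])
      show "hits (T \<inter> l \<times> UNIV) x \<le> D" if "x \<in> Y" for x
        using hits_mono[OF fin[OF T], of "T \<inter> l \<times> UNIV" x] Dhits[OF T that] by (meson Int_lower1 le_trans)
    qed (use sub[OF T] c in auto)
  qed
  then have "learn k D (split_cost j \<delta>) v Y (\<lambda>Z. \<forall>T\<in>A. G T Z)"
    by (rule learn_mono_time)
      (use A_cost k in \<open>auto simp: G_def intro!: hereditary_ball hereditary_constant_on\<close>)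
  then show ?thesis
  proof (rule learn_weaken[OF _ order.refl order.refl v(1) k])
    fix Z assume ZY: "Z \<subseteq> Y" and Z: "\<forall>T\<in>A. G T Z"
    show "\<exists>F\<subseteq>W. tokens d Z F \<and>
      tokens D Z ((W - F) \<inter> l \<times> UNIV) \<and> tokens D Z ((W - F) \<inter> r \<times> UNIV)"
    proof (intro exI conjI)
      show "F \<subseteq> W" unfolding F_def using P(3) by blast
      have "pairwise disjnt (P - A)" by (rule pairwise_subset[OF P(2)]) blast
      then have "tokens d Y F"
        unfolding tokens_def F_def using P(1) by (intro exI[of _ "P - A"]) (auto simp: A_def)
      then show "tokens d Z F" using hereditaryD[OF hereditary_tokens _ ZY] by blast
      have part: "tokens D Z ((W - F) \<inter> u \<times> UNIV)"
        if u: "\<And>T. T \<in> A \<Longrightarrow> hits (T \<inter> u \<times> UNIV) constant_on Z" for u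
      proof -
        have "tokens D Z (\<Union>T\<in>A. T \<inter> u \<times> UNIV)"
        proof (rule tokens_UN[OF AP(2)])
          show "disjoint_family_on (\<lambda>T. T \<inter> u \<times> UNIV) A"
            unfolding disjoint_family_on_def
          proof (intro ballI impI)
            fix S T assume "S \<in> A" "T \<in> A" "S \<noteq> T"
            then have "disjnt S T" using P(2) AP(1) by (meson pairwiseD subsetD)
            then show "(S \<inter> u \<times> UNIV) \<inter> (T \<inter> u \<times> UNIV) = {}" unfolding disjnt_def by blast
          qed
          fix T assume T: "T \<in> A"
          have TP: "T \<in> P" using T AP(1) by blast
          obtain c where c: "snd ` T \<subseteq> {c}" using P(4)[OF TP] unfolding token_def by blast
          have "hits (T \<inter> u \<times> UNIV) x \<le> D" if "x \<in> Z" for x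
            using hits_mono[OF fin[OF TP], of "T \<inter> u \<times> UNIV" x] Dhits[OF TP] ZY that
            by (meson Int_lower1 le_trans subsetD)
          then have "token D Z (T \<inter> u \<times> UNIV)"
            unfolding token_def using u[OF T] c by (intro conjI exI[of _ c] disjI2 ballI) auto
          then show "tokens D Z (T \<inter> u \<times> UNIV)"
            unfolding tokens_def by (intro exI[of _ "{T \<inter> u \<times> UNIV}"]) auto
        qed
        moreover have "\<Union>A \<inter> u \<times> UNIV = (\<Union>T\<in>A. T \<inter> u \<times> UNIV)" by blast
        ultimately show ?thesis unfolding WF by (simp only:)
      qed
      show "tokens D Z ((W - F) \<inter> l \<times> UNIV)"
        using Z unfolding G_def by (intro part) blast
      show "tokens D Z ((W - F) \<inter> r \<times> UNIV)"
      proof (rule part, rule constant_onI)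
        fix T x y assume T: "T \<in> A" and xy: "x \<in> Z" "y \<in> Z"
        have TP: "T \<in> P" using T AP by blast
        have T_eq: "(T \<inter> l \<times> UNIV) \<union> (T \<inter> r \<times> UNIV) = T" using sub[OF TP] v(3) by blast
        have eq: "hits T z = hits (T \<inter> l \<times> UNIV) z + hits (T \<inter> r \<times> UNIV) z" for z
        proof -
          have "(T \<inter> l \<times> UNIV) \<inter> (T \<inter> r \<times> UNIV) = {}" using v(4) by blast
          then show ?thesis
            using fin[OF TP] T_eq hits_Un[of "T \<inter> l \<times> UNIV" "T \<inter> r \<times> UNIV" z] by auto
        qed
        have "hits T x = hits T y"
          using P(4)[OF TP] xy ZY constant_onD[of "hits T" Y x y] unfolding token_def by blast
        moreover have "hits (T \<inter> l \<times> UNIV) x = hits (T \<inter> l \<times> UNIV) y"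
          using bspec[OF Z T] constant_onD[OF _ xy] unfolding G_def by blast
        ultimately show "hits (T \<inter> r \<times> UNIV) x = hits (T \<inter> r \<times> UNIV) y" using eq by simp
      qed
    qed
  qed
qed

section \<open>Repeated bisection of a region\<close>

lemma halves:
  assumes "finite v" "card v \<le> 2 ^ \<delta>"
  obtains l r where "l \<union> r = v" "l \<inter> r = {}" "card l \<le> 2 ^ (\<delta> - 1)" "card r \<le> 2 ^ (\<delta> - 1)"
proof -
  obtain l where l: "l \<subseteq> v" "card l = min (card v) (2 ^ (\<delta> - 1))"
    using obtain_subset_with_card_n[of "min (card v) (2 ^ (\<delta> - 1))" v] by auto
  have "card (v - l) = card v - card l" using l(1) assms(1) by (meson card_Diff_subset finite_subset)
  also have "\<dots> \<le> 2 ^ (\<delta> - 1)" using l(2) assms(2) by (cases \<delta>) auto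
  finally show ?thesis using l that[of l "v - l"] by auto
qed

text \<open>Keeps each level of bisection within the cost of the first: the pieces double in number
  while the cost of each at least halves.\<close>

lemma split_cost_halve: "2 * split_cost j (\<delta> - 1) \<le> split_cost j \<delta>"
proof (cases "\<delta> \<le> 1")
  case False
  then obtain e where e: "\<delta> = Suc e" "e \<noteq> 0" by (cases \<delta>) auto
  have "2 * (2 ^ e div 2 ^ j) * 2 ^ j \<le> 2 * (2 ^ e :: nat)"
    using div_times_less_eq_dividend[of "2 ^ e" "2 ^ j :: nat"] by linarith
  then show ?thesis using e by (simp add: split_cost_def less_eq_div_iff_mult_less_eq)
qed (simp add: split_cost_def)

text \<open>The parts depend on \<open>v\<close> alone and are fixed before \<open>Y\<close> and
  \<open>W\<close>. Each of the \<open>\<mu>\<close> levels of bisection costs at most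
  \<open>split_cost j \<delta>\<close> over all its pieces. For \<open>\<mu> > \<delta>\<close> the
  truncated exponent leaves parts with at most one position.\<close>

lemma distribute_tokens:
  fixes j :: nat
  defines "D \<equiv> 2 ^ (j + 1) - 1" and "d \<equiv> 2 ^ j - 1"
  assumes k: "k \<ge> 1" and v: "finite v" "card v \<le> 2 ^ \<delta>"
  shows "\<exists>part :: nat \<Rightarrow> nat set. disjoint_family_on part {..<2 ^ \<mu>} \<and> (\<Union>p<2 ^ \<mu>. part p) = v \<and>
    (\<forall>p<2 ^ \<mu>. card (part p) \<le> 2 ^ (\<delta> - \<mu>)) \<and>
    (\<forall>Y W. W \<subseteq> v \<times> {1..k} \<longrightarrow> tokens D Y W \<longrightarrow> blank_colour k Y v \<longrightarrow>
      learn k D (\<mu> * split_cost j \<delta>) v Y (\<lambda>Z. \<exists>F\<subseteq>W. tokens d Z F \<and>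
        (\<forall>p<2 ^ \<mu>. tokens D Z ((W - F) \<inter> part p \<times> UNIV))))"
  using v
proof (induction \<mu> arbitrary: v \<delta>)
  case 0
  have "\<exists>F\<subseteq>W. tokens d Y F \<and> tokens D Y ((W - F) \<inter> v \<times> UNIV)"
    if "W \<subseteq> v \<times> {1..k}" "tokens D Y W" for W Y
  proof -
    have "(W - {}) \<inter> v \<times> UNIV = W" using that(1) by blast
    then show ?thesis using that(2) tokens_empty by (metis empty_subsetI)
  qed
  then show ?case
    using 0 by (intro exI[of _ "\<lambda>_. v"]) (auto simp: disjoint_family_on_def)
next
  case (Suc \<mu>)
  obtain l r where lr: "l \<union> r = v" "l \<inter> r = {}" "card l \<le> 2 ^ (\<delta> - 1)" "card r \<le> 2 ^ (\<delta> - 1)"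
    using halves[OF Suc.prems] .
  have fin: "finite l" "finite r" using lr(1) Suc.prems(1) by auto
  define good where "good u part \<longleftrightarrow> disjoint_family_on part {..<2 ^ \<mu>} \<and> (\<Union>p<2 ^ \<mu>. part p) = u \<and>
    (\<forall>p<2 ^ \<mu>. card (part p) \<le> 2 ^ (\<delta> - 1 - \<mu>)) \<and>
    (\<forall>Y W. W \<subseteq> u \<times> {1..k} \<longrightarrow> tokens D Y W \<longrightarrow> blank_colour k Y u \<longrightarrow>
      learn k D (\<mu> * split_cost j (\<delta> - 1)) u Y (\<lambda>Z. \<exists>F\<subseteq>W. tokens d Z F \<and>
        (\<forall>p<2 ^ \<mu>. tokens D Z ((W - F) \<inter> part p \<times> UNIV))))" for u and part :: "nat \<Rightarrow> nat set"
  obtain pl where pl: "good l pl" using Suc.IH[OF fin(1) lr(3)] unfolding good_def by blast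
  obtain pr where pr: "good r pr" using Suc.IH[OF fin(2) lr(4)] unfolding good_def by blast
  define part where "part p = (if p < 2 ^ \<mu> then pl p else pr (p - 2 ^ \<mu>))" for p
  have part_r: "part (2 ^ \<mu> + q) = pr q" for q by (simp add: part_def)
  have part_l: "part q = pl q" if "q < 2 ^ \<mu>" for q using that by (simp add: part_def)
  have subl: "pl p \<subseteq> l" and subr: "pr p \<subseteq> r" if "p < 2 ^ \<mu>" for p
    using pl pr that unfolding good_def by blast+
  have all_less: "(\<forall>p<2 ^ Suc \<mu>. Q p) \<longleftrightarrow> (\<forall>p<2 ^ \<mu>. Q p) \<and> (\<forall>p<2 ^ \<mu>. Q (2 ^ \<mu> + p))"
    for Q :: "nat \<Rightarrow> bool"
  proof safe
    fix p :: nat assume *: "\<forall>p<2 ^ \<mu>. Q p" "\<forall>p<2 ^ \<mu>. Q (2 ^ \<mu> + p)" "p < 2 ^ Suc \<mu>"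
    show "Q p"
    proof (cases "p < 2 ^ \<mu>")
      case False
      then have "p - 2 ^ \<mu> < 2 ^ \<mu>" "p = 2 ^ \<mu> + (p - 2 ^ \<mu>)" using *(3) by auto
      then show ?thesis using *(2) by metis
    qed (use * in blast)
  qed auto
  have "disjoint_family_on part {..<2 ^ Suc \<mu>}"
  proof -
    have "\<forall>p<2 ^ Suc \<mu>. \<forall>q<2 ^ Suc \<mu>. p \<noteq> q \<longrightarrow> part p \<inter> part q = {}"
      unfolding all_less part_r using pl pr lr(2) subl subr
      by (simp add: part_l good_def disjoint_family_on_def) blast
    then show ?thesis unfolding disjoint_family_on_def by simp
  qed
  moreover have "(\<Union>p<2 ^ Suc \<mu>. part p) = v"
  proof -
    have "i \<in> (\<Union>p<2 ^ Suc \<mu>. part p) \<longleftrightarrow> i \<in> v" for i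
    proof -
      have "i \<notin> (\<Union>p<2 ^ Suc \<mu>. part p) \<longleftrightarrow> (\<forall>p<2 ^ Suc \<mu>. i \<notin> part p)" by auto
      also have "\<dots> \<longleftrightarrow> i \<notin> l \<and> i \<notin> r"
        unfolding all_less part_r using pl pr by (auto simp: part_l good_def)
      finally show ?thesis using lr(1) by blast
    qed
    then show ?thesis by blast
  qed
  moreover have "\<forall>p<2 ^ Suc \<mu>. card (part p) \<le> 2 ^ (\<delta> - Suc \<mu>)"
    unfolding all_less part_r using pl pr by (simp add: part_l good_def)
  moreover have "learn k D (Suc \<mu> * split_cost j \<delta>) v Y (\<lambda>Z. \<exists>F\<subseteq>W. tokens d Z F \<and>
        (\<forall>p<2 ^ Suc \<mu>. tokens D Z ((W - F) \<inter> part p \<times> UNIV)))" (is "learn k D _ v Y ?goal")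
    if W: "W \<subseteq> v \<times> {1..k}" "tokens D Y W" "blank_colour k Y v" for Y W
  proof -
    have hered: "hereditary ?goal"
      using hereditaryD[OF hereditary_tokens] unfolding hereditary_def by blast
    \<comment> \<open>One split at the top, then the left and the right half in turn; tokens
      finished at any stage go into a common \<open>F\<close>.\<close>
    have "learn k D (split_cost j \<delta> + (\<mu> * split_cost j (\<delta> - 1) + (\<mu> * split_cost j (\<delta> - 1) + 0))) v Y ?goal"
    proof (rule learn_seq)
      show "learn k D (split_cost j \<delta>) v Y (\<lambda>Z. \<exists>F\<subseteq>W. tokens d Z F \<and>
        tokens D Z ((W - F) \<inter> l \<times> UNIV) \<and> tokens D Z ((W - F) \<inter> r \<times> UNIV))"
        unfolding D_def d_def using split_tokens[OF k Suc.prems lr(1,2) W(1) W(2)[unfolded D_def] W(3)] .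
      fix Z assume ZY: "Z \<subseteq> Y" and "\<exists>F\<subseteq>W. tokens d Z F \<and>
        tokens D Z ((W - F) \<inter> l \<times> UNIV) \<and> tokens D Z ((W - F) \<inter> r \<times> UNIV)"
      then obtain F where F: "F \<subseteq> W" "tokens d Z F"
        "tokens D Z ((W - F) \<inter> l \<times> UNIV)" "tokens D Z ((W - F) \<inter> r \<times> UNIV)" by blast
      have step: "learn k D (\<mu> * split_cost j (\<delta> - 1)) v Z' (\<lambda>Z. \<exists>F'\<subseteq>(W - F) \<inter> u \<times> UNIV. tokens d Z F' \<and>
        (\<forall>p<2 ^ \<mu>. tokens D Z (((W - F) \<inter> u \<times> UNIV - F') \<inter> pu p \<times> UNIV)))"
        if u: "good u pu" "u \<subseteq> v" "tokens D Z ((W - F) \<inter> u \<times> UNIV)" "Z' \<subseteq> Z" for u pu Z'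
      proof (rule learn_weaken[OF _ order.refl u(2) Suc.prems(1) k])
        have "(W - F) \<inter> u \<times> UNIV \<subseteq> u \<times> {1..k}" using W(1) by blast
        moreover have "tokens D Z' ((W - F) \<inter> u \<times> UNIV)"
          using hereditaryD[OF hereditary_tokens u(3,4)] .
        moreover have "blank_colour k Z' u" using blank_colour_subset[OF W(3)] ZY u by blast
        ultimately show "learn k D (\<mu> * split_cost j (\<delta> - 1)) u Z' (\<lambda>Z. \<exists>F'\<subseteq>(W - F) \<inter> u \<times> UNIV. tokens d Z F' \<and>
          (\<forall>p<2 ^ \<mu>. tokens D Z (((W - F) \<inter> u \<times> UNIV - F') \<inter> pu p \<times> UNIV)))"
          using u(1) unfolding good_def by blast
      qed
      show "learn k D (\<mu> * split_cost j (\<delta> - 1) + (\<mu> * split_cost j (\<delta> - 1) + 0)) v Z ?goal"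
      proof (rule learn_seq[OF step[OF pl _ F(3) order.refl]], use lr in blast)
        fix Z1 assume Z1: "Z1 \<subseteq> Z" and "\<exists>F'\<subseteq>(W - F) \<inter> l \<times> UNIV. tokens d Z1 F' \<and>
          (\<forall>p<2 ^ \<mu>. tokens D Z1 (((W - F) \<inter> l \<times> UNIV - F') \<inter> pl p \<times> UNIV))"
        then obtain F1 where F1: "F1 \<subseteq> (W - F) \<inter> l \<times> UNIV" "tokens d Z1 F1"
          "\<And>p. p < 2 ^ \<mu> \<Longrightarrow> tokens D Z1 (((W - F) \<inter> l \<times> UNIV - F1) \<inter> pl p \<times> UNIV)" by blast
        show "learn k D (\<mu> * split_cost j (\<delta> - 1) + 0) v Z1 ?goal"
        proof (rule learn_seq[OF step[OF pr _ F(4) Z1]], use lr in blast)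
          fix Z2 assume Z2: "Z2 \<subseteq> Z1" and "\<exists>F'\<subseteq>(W - F) \<inter> r \<times> UNIV. tokens d Z2 F' \<and>
            (\<forall>p<2 ^ \<mu>. tokens D Z2 (((W - F) \<inter> r \<times> UNIV - F') \<inter> pr p \<times> UNIV))"
          then obtain F2 where F2: "F2 \<subseteq> (W - F) \<inter> r \<times> UNIV" "tokens d Z2 F2"
            "\<And>p. p < 2 ^ \<mu> \<Longrightarrow> tokens D Z2 (((W - F) \<inter> r \<times> UNIV - F2) \<inter> pr p \<times> UNIV)" by blast
          have disj: "F \<inter> F1 = {}" "(F \<union> F1) \<inter> F2 = {}" using F1(1) F2(1) lr(2) by blast+
          have "tokens d Z2 (F \<union> F1 \<union> F2)"
            using hereditaryD[OF hereditary_tokens F(2), of Z2] hereditaryD[OF hereditary_tokens F1(2) Z2]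
              Z1 Z2 F2(2) disj by (intro tokens_Un) auto
          moreover have "(W - (F \<union> F1 \<union> F2)) \<inter> pl p \<times> UNIV = ((W - F) \<inter> l \<times> UNIV - F1) \<inter> pl p \<times> UNIV"
            if "p < 2 ^ \<mu>" for p
            using subl[OF that] F2(1) lr(2) by blast
          moreover have "(W - (F \<union> F1 \<union> F2)) \<inter> pr p \<times> UNIV = ((W - F) \<inter> r \<times> UNIV - F2) \<inter> pr p \<times> UNIV"
            if "p < 2 ^ \<mu>" for p
            using subr[OF that] F1(1) lr(2) by blast
          ultimately have "?goal Z2"
            unfolding all_less part_r
            using F(1) F1(1,3) F2(1,3) hereditaryD[OF hereditary_tokens _ Z2]
            by (intro exI[of _ "F \<union> F1 \<union> F2"]) (auto simp: part_l)
          then show "learn k D 0 v Z2 ?goal" by simp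
        qed
      qed
    qed
    moreover have "split_cost j \<delta> + (\<mu> * split_cost j (\<delta> - 1) + (\<mu> * split_cost j (\<delta> - 1) + 0))
        \<le> Suc \<mu> * split_cost j \<delta>"
    proof -
      have "\<mu> * (2 * split_cost j (\<delta> - 1)) \<le> \<mu> * split_cost j \<delta>"
        by (rule mult_le_mono2[OF split_cost_halve])
      moreover have "\<mu> * (2 * split_cost j (\<delta> - 1)) = \<mu> * split_cost j (\<delta> - 1) + \<mu> * split_cost j (\<delta> - 1)"
        by simp
      ultimately show ?thesis unfolding mult_Suc by linarith
    qed
    ultimately show ?thesis using hered k by (rule learn_mono_time)
  qed
  ultimately show ?case by blast
qed

text \<open>Fewer than \<open>2 ^ j\<close> positions cannot hold \<open>2 ^ j\<close> hits, and on
  at most one position a token of one colour has at most one cell.\<close>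

lemma tokens_small:
  assumes "W \<subseteq> v \<times> {1..k}" "finite v" "tokens D Z W" "card v \<le> 2 ^ s" "s < j \<or> s = 0"
  shows "tokens (2 ^ j - 1) Z W"
proof -
  obtain P where P: "finite P" "pairwise disjnt P" "\<Union>P = W" "\<And>T. T \<in> P \<Longrightarrow> token D Z T"
    using assms(3) unfolding tokens_def by blast
  have "token (2 ^ j - 1) Z T" if TP: "T \<in> P" for T
  proof -
    have T: "T \<subseteq> v \<times> UNIV" using TP P(3) assms(1) by blast
    obtain c where c: "snd ` T \<subseteq> {c}" using P(4)[OF TP] unfolding token_def by blast
    have "card T \<le> 1 \<or> (\<forall>x\<in>Z. hits T x \<le> 2 ^ j - 1)"
    proof (cases "s = 0")
      case True
      then show ?thesis using card_monochrome[OF T assms(2) c] assms(4) by auto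
    next
      case False
      then have "(2::nat) ^ s < 2 ^ j" using assms(5) by simp
      then have "hits T x \<le> 2 ^ j - 1" for x
        using hits_le_card[OF T assms(2), of x] assms(4) by linarith
      then show ?thesis by blast
    qed
    then show ?thesis using P(4)[OF TP] unfolding token_def by blast
  qed
  then show ?thesis using P unfolding tokens_def by blast
qed

lemma tokens_reassemble:
  fixes part :: "'i \<Rightarrow> nat set"
  assumes "F \<subseteq> W" "tokens d Z F" "disjoint_family_on part I" "finite I" "W \<subseteq> (\<Union>p\<in>I. part p) \<times> UNIV"
    "\<And>p. p \<in> I \<Longrightarrow> tokens d Z ((W - F) \<inter> part p \<times> UNIV)"
  shows "tokens d Z W"
proof -
  have "tokens d Z (F \<union> (\<Union>p\<in>I. (W - F) \<inter> part p \<times> UNIV))"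
  proof (intro tokens_Un tokens_UN)
    show "disjoint_family_on (\<lambda>p. (W - F) \<inter> part p \<times> UNIV) I"
      using assms(3) unfolding disjoint_family_on_def by blast
  qed (use assms in auto)
  moreover have "F \<union> (\<Union>p\<in>I. (W - F) \<inter> part p \<times> UNIV) = W" using assms(1,5) by blast
  ultimately show ?thesis by simp
qed


text \<open>Base case of the recursion in \<open>learn_prepare\<close>: after
  \<open>2 * j + 2\<close> bisections every part has fewer than \<open>2 ^ j\<close> positions or at
  most one, so all tokens are finished. The factor 4 matches the general bound.\<close>

lemma learn_finish_leaf:
  assumes k: "k \<ge> 1" and v: "finite v" "card v \<le> 2 ^ \<delta>" and \<delta>: "\<delta> < j + (2 * j + 2)"
    and W: "W \<subseteq> v \<times> {1..k}" "tokens (2 ^ (j + 1) - 1) Y W" "blank_colour k Y v"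
  shows "learn k \<infinity> (4 * (2 * j + 2) * (2 ^ \<delta> div 2 ^ j)) v Y (\<lambda>Z. tokens (2 ^ j - 1) Z W)"
proof -
  obtain part :: "nat \<Rightarrow> nat set" where part: "disjoint_family_on part {..<2 ^ (2 * j + 2)}" "(\<Union>p<2 ^ (2 * j + 2). part p) = v"
    "\<And>p. p < 2 ^ (2 * j + 2) \<Longrightarrow> card (part p) \<le> 2 ^ (\<delta> - (2 * j + 2))"
    "learn k (2 ^ (j + 1) - 1 :: nat) ((2 * j + 2) * split_cost j \<delta>) v Y (\<lambda>Z. \<exists>F\<subseteq>W. tokens (2 ^ j - 1) Z F \<and>
        (\<forall>p<2 ^ (2 * j + 2). tokens (2 ^ (j + 1) - 1) Z ((W - F) \<inter> part p \<times> UNIV)))"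
    using distribute_tokens[OF k v, of "2 * j + 2" j] W by blast
  have "learn k \<infinity> ((2 * j + 2) * split_cost j \<delta>) v Y (\<lambda>Z. tokens (2 ^ j - 1) Z W)"
  proof (rule learn_weaken[OF part(4) _ order.refl v(1) k])
    fix Z assume "\<exists>F\<subseteq>W. tokens (2 ^ j - 1) Z F \<and>
        (\<forall>p<2 ^ (2 * j + 2). tokens (2 ^ (j + 1) - 1) Z ((W - F) \<inter> part p \<times> UNIV))"
    then obtain F where F: "F \<subseteq> W" "tokens (2 ^ j - 1) Z F"
      "\<And>p. p < 2 ^ (2 * j + 2) \<Longrightarrow> tokens (2 ^ (j + 1) - 1) Z ((W - F) \<inter> part p \<times> UNIV)" by blast
    show "tokens (2 ^ j - 1) Z W"
    proof (rule tokens_reassemble[OF F(1,2) part(1)])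
      fix p :: nat assume "p \<in> {..<2 ^ (2 * j + 2)}"
      then have p: "p < 2 ^ (2 * j + 2)" by simp
      show "tokens (2 ^ j - 1) Z ((W - F) \<inter> part p \<times> UNIV)"
      proof (rule tokens_small[OF _ _ F(3)[OF p] part(3)[OF p]])
        show "(W - F) \<inter> part p \<times> UNIV \<subseteq> part p \<times> {1..k}" using W(1) by blast
        show "finite (part p)" using p part(2) v(1) by (auto intro: finite_subset)
        show "\<delta> - (2 * j + 2) < j \<or> \<delta> - (2 * j + 2) = 0" using \<delta> by linarith
      qed
    qed (use W(1) part(2) in auto)
  qed simp
  then show ?thesis
  proof (rule learn_mono_time[OF _ _ hereditary_tokens k])
    have "split_cost j \<delta> \<le> 2 ^ \<delta> div 2 ^ j" by (simp add: split_cost_def)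
    then have "(2 * j + 2) * split_cost j \<delta> \<le> (2 * j + 2) * (2 ^ \<delta> div 2 ^ j)" by (rule mult_le_mono2)
    then show "(2 * j + 2) * split_cost j \<delta> \<le> 4 * (2 * j + 2) * (2 ^ \<delta> div 2 ^ j)" by linarith
  qed
qed

text \<open>
  The recursion behind the linear bound. A region is cut into \<open>2 * h\<close> parts with \<open>h = 2 ^ (2 * j + 1)\<close>,
  and \<^emph>\<open>preparing\<close> it means distributing its tokens among the parts and preparing only the first \<open>h\<close>
  of them. When it is solved later, the first \<open>h\<close> parts are solved in parallel, and this carries
  the preparation of the other \<open>h\<close> parts for free.
\<close>

lemma learn_prepare:
  assumes k: "k \<ge> 1" and "finite v" "card v \<le> 2 ^ \<delta>"
    and "W \<subseteq> v \<times> {1..k}" "tokens (2 ^ (j + 1) - 1) Y W" "blank_colour k Y v"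
  shows "learn k (2 ^ (j + 1) - 1 :: nat) (2 * (2 * j + 2) * (2 ^ \<delta> div 2 ^ j)) v Y
    (\<lambda>Z. learn k \<infinity> (4 * (2 * j + 2) * (2 ^ \<delta> div 2 ^ j)) v Z (\<lambda>Z. tokens (2 ^ j - 1) Z W))"
  using assms(2-)
proof (induction \<delta> arbitrary: v Y W rule: less_induct)
  case (less \<delta>)
  define L where "L = 2 * j + 2"
  define D d :: nat where "D = 2 ^ (j + 1) - 1" and "d = 2 ^ j - 1"
  let ?solved = "\<lambda>c v W Z. learn k \<infinity> (4 * L * c) v Z (\<lambda>Z. tokens d Z W)"
  have hered: "hereditary (?solved c v W)" for c v W
    by (intro hereditary_learn hereditary_tokens)
  have fin: "finite v" using less.prems by blast
  show ?case unfolding L_def[symmetric] D_def[symmetric] d_def[symmetric]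
  proof (cases "\<delta> < j + L")
    case True
    \<comment> \<open>Small regions need no preparation: they are solved directly later.\<close>
    have "learn k D 0 v Y (?solved (2 ^ \<delta> div 2 ^ j) v W)"
      using learn_finish_leaf[OF k less.prems(1,2) _ less.prems(3-5)] True by (simp add: L_def d_def)
    then show "learn k D (2 * L * (2 ^ \<delta> div 2 ^ j)) v Y (?solved (2 ^ \<delta> div 2 ^ j) v W)"
      by (rule learn_mono_time[OF _ _ hered k]) simp
  next
    case False
    \<comment> \<open>\<open>c\<close> is the value of \<open>2 ^ \<delta> div 2 ^ j\<close> for a
      single part; for the whole region it is \<open>2 ^ L * c = 2 * h * c\<close>.\<close>
    define c :: nat where "c = 2 ^ (\<delta> - L - j)"
    have "\<delta> = j + (L + (\<delta> - L - j))" "\<delta> - L = j + (\<delta> - L - j)" using False by linarith+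
    then have "(2::nat) ^ \<delta> = 2 ^ j * (2 ^ L * c)" "(2::nat) ^ (\<delta> - L) = 2 ^ j * c"
      unfolding c_def by (metis power_add)+
    then have div: "(2::nat) ^ \<delta> div 2 ^ j = 2 ^ L * c" "(2::nat) ^ (\<delta> - L) div 2 ^ j = c" by simp_all
    define h :: nat where "h = 2 ^ (2 * j + 1)"
    have h: "2 ^ L = 2 * h" "h = 2 * 2 ^ (2 * j)" by (simp_all add: h_def L_def)
    obtain part :: "nat \<Rightarrow> nat set" where part: "disjoint_family_on part {..<2 ^ L}" "(\<Union>p<2 ^ L. part p) = v"
      "\<And>p. p < 2 ^ L \<Longrightarrow> card (part p) \<le> 2 ^ (\<delta> - L)"
      "learn k D (L * split_cost j \<delta>) v Y (\<lambda>Z. \<exists>F\<subseteq>W. tokens d Z F \<and>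
          (\<forall>p<2 ^ L. tokens D Z ((W - F) \<inter> part p \<times> UNIV)))"
      using distribute_tokens[OF k less.prems(1,2), of L j] less.prems(3-5) unfolding D_def d_def by blast
    have sub: "part p \<subseteq> v" if "p < 2 ^ L" for p using part(2) that by blast
    have finp: "finite (part p)" if "p < 2 ^ L" for p using finite_subset[OF sub[OF that] fin] .
    define cells where "cells F p = (W - F) \<inter> part p \<times> UNIV" for F p
    have cells: "cells F p \<subseteq> part p \<times> {1..k}" for F p using less.prems(3) unfolding cells_def by blast
    have prep: "learn k D (2 * L * c) (part p) Z (?solved c (part p) (cells F p))"
      if "p < 2 ^ L" "Z \<subseteq> Y" "tokens D Z (cells F p)" for p Z F
    proof -
      have "\<delta> - L < \<delta>" using False by (simp add: L_def)
      moreover have "blank_colour k Z (part p)"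
        using blank_colour_subset[OF less.prems(5) that(2) sub[OF that(1)]] .
      ultimately show ?thesis
        using less.IH[of "\<delta> - L" "part p" "cells F p" Z] finp part(3) that cells
        unfolding div(2) L_def[symmetric] D_def[symmetric] d_def[symmetric] by blast
    qed
    have widen: "learn k D' t u Z G" if "learn k D' t (part p) Z G" "p < 2 ^ L" "part p \<subseteq> u" "finite u"
      for D' t u Z G p
      using learn_weaken[OF that(1) order.refl that(3,4) k] by blast
    define V where "V = (\<Union>p\<in>{h..<2 * h}. part p)"
    have V: "finite V" "\<And>p. p \<in> {h..<2 * h} \<Longrightarrow> part p \<subseteq> V"
      unfolding V_def using finp h by auto
    have total: "(\<Union>p\<in>{..<h}. part p) \<union> V = v"
    proof -
      have "{..<2 ^ L} = {..<h} \<union> {h..<2 * h}" unfolding h(1) by auto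
      then show ?thesis unfolding V_def part(2)[symmetric] by auto
    qed
    \<comment> \<open>Distributing costs at most \<open>L * (2 * h * c)\<close> and preparing
      \<open>h\<close> parts \<open>h * (2 * L * c)\<close>; together this is
      \<open>2 * L * (2 * h * c)\<close>, the bound of the induction.\<close>
    have "learn k D (L * split_cost j \<delta> + h * (2 * L * c)) v Y (?solved (2 ^ \<delta> div 2 ^ j) v W)"
    proof (rule learn_seq[OF part(4)])
      fix Z assume ZY: "Z \<subseteq> Y" and "\<exists>F\<subseteq>W. tokens d Z F \<and> (\<forall>p<2 ^ L. tokens D Z ((W - F) \<inter> part p \<times> UNIV))"
      then obtain F where F: "F \<subseteq> W" "tokens d Z F" "\<And>p. p < 2 ^ L \<Longrightarrow> tokens D Z (cells F p)"
        unfolding cells_def by blast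
      have "learn k D (card {..<h} * (2 * L * c)) v Z (\<lambda>Z. \<forall>p\<in>{..<h}. ?solved c (part p) (cells F p) Z)"
      proof (rule learn_all[OF _ _ hered])
        fix p assume "p \<in> {..<h}"
        then have p: "p < 2 ^ L" using h by simp
        show "learn k D (2 * L * c) v Z (?solved c (part p) (cells F p))"
          by (rule widen[OF prep[OF p ZY F(3)[OF p]] p sub[OF p] fin])
      qed simp
      then have "learn k D (h * (2 * L * c)) v Z (\<lambda>Z. \<forall>p\<in>{..<h}. ?solved c (part p) (cells F p) Z)" by simp
      then show "learn k D (h * (2 * L * c)) v Z (?solved (2 ^ \<delta> div 2 ^ j) v W)"
      proof (rule learn_weaken[OF _ order.refl order.refl fin k])
        fix X assume XZ: "X \<subseteq> Z" and first: "\<forall>p\<in>{..<h}. ?solved c (part p) (cells F p) X"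
        have tokX: "tokens D X (cells F p)" if "p < 2 ^ L" for p
          using hereditaryD[OF hereditary_tokens F(3)[OF that] XZ] .
        let ?G = "\<lambda>p Z. tokens d Z (cells F p)"
        let ?H = "\<lambda>Z. \<forall>p\<in>{h..<2 * h}. ?solved c (part p) (cells F p) Z"
        have "learn k D (card {h..<2 * h} * (2 * L * c)) V X ?H"
        proof (rule learn_all[OF _ _ hered])
          fix p assume p: "p \<in> {h..<2 * h}"
          then have p': "p < 2 ^ L" using h by simp
          show "learn k D (2 * L * c) V X (?solved c (part p) (cells F p))"
            by (rule widen[OF prep[OF p' _ tokX[OF p']] p' V(2)[OF p] V(1)]) (use XZ ZY in blast)
        qed simp
        \<comment> \<open>Preparing the other \<open>h\<close> parts takes exactly as many questions
          as \<open>4 * L * c\<close> parallel rounds carry for free.\<close>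
        moreover have "card {h..<2 * h} * (2 * L * c) = 4 * L * c * 2 ^ (2 * j)"
          using h(2) by simp
        ultimately have chain: "learn k (2 ^ (j + 1) - 1 :: nat) (4 * L * c * 2 ^ (2 * j)) V X ?H"
          unfolding D_def by (simp only:)
        have "learn k \<infinity> (4 * L * c * 2 ^ (2 * j + 1)) ((\<Union>p\<in>{..<h}. part p) \<union> V) X
            (\<lambda>Z. (\<forall>p\<in>{..<h}. ?G p Z) \<and> ?H Z)"
        proof (rule learn_parallel[OF k _ _ _ _ V(1) _ _ _ _ chain])
          show "disjoint_family_on part {..<h}"
            using part(1) h(1) unfolding disjoint_family_on_def by auto
          show "part p \<inter> V = {}" if "p \<in> {..<h}" for p
          proof -
            have "part p \<inter> part q = {}" if "q \<in> {h..<2 * h}" for q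
              using disjoint_family_onD[OF part(1), of p q] \<open>p \<in> {..<h}\<close> that h(1) by auto
            then show ?thesis unfolding V_def by blast
          qed
          show "learn k \<infinity> (4 * L * c) (part p) X (?G p)" if "p \<in> {..<h}" for p
            using first that by blast
        qed (use h finp hered in \<open>auto simp: h_def[symmetric] intro!: hereditary_tokens hereditary_ball\<close>)
        \<comment> \<open>Both halves cost \<open>4 * L * c * h\<close>: the first in parallel, the
          second, now prepared, part by part.\<close>
        then have "learn k \<infinity> (4 * L * c * h + card {h..<2 * h} * (4 * L * c)) v X (\<lambda>Z. tokens d Z W)"
          unfolding total h_def[symmetric]
        proof (rule learn_seq)
          fix X' assume X': "X' \<subseteq> X" "(\<forall>p\<in>{..<h}. ?G p X') \<and> ?H X'"
          have "learn k \<infinity> (card {h..<2 * h} * (4 * L * c)) v X' (\<lambda>Z. \<forall>p\<in>{h..<2 * h}. ?G p Z)"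
          proof (rule learn_all[OF _ _ hereditary_tokens])
            fix p assume p: "p \<in> {h..<2 * h}"
            then have p': "p < 2 ^ L" using h by simp
            show "learn k \<infinity> (4 * L * c) v X' (?G p)"
              by (rule widen[OF _ p' sub[OF p'] fin]) (use X'(2) p in blast)
          qed simp
          then show "learn k \<infinity> (card {h..<2 * h} * (4 * L * c)) v X' (\<lambda>Z. tokens d Z W)"
          proof (rule learn_weaken[OF _ order.refl order.refl fin k])
            fix X'' assume X'': "X'' \<subseteq> X'" "\<forall>p\<in>{h..<2 * h}. ?G p X''"
            show "tokens d X'' W"
            proof (rule tokens_reassemble[OF F(1) _ part(1)])
              show "tokens d X'' F"
                using hereditaryD[OF hereditary_tokens F(2)] XZ X'(1) X''(1) by blast
              show "W \<subseteq> (\<Union>p\<in>{..<2 ^ L}. part p) \<times> UNIV" unfolding part(2) using less.prems(3) by blast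
              fix p :: nat assume p: "p \<in> {..<2 ^ L}"
              show "tokens d X'' ((W - F) \<inter> part p \<times> UNIV)"
                unfolding cells_def[symmetric]
              proof (cases "p < h")
                case True
                then have "?G p X'" using X'(2) by blast
                then show "?G p X''" using hereditaryD[OF hereditary_tokens _ X''(1)] by blast
              next
                case False
                then show "?G p X''" using X''(2) p h(1) by auto
              qed
            qed simp
          qed
        qed
        moreover have "4 * L * c * h + card {h..<2 * h} * (4 * L * c) = 4 * L * (2 ^ \<delta> div 2 ^ j)"
          unfolding div(1) h(1) by simp
        ultimately show "?solved (2 ^ \<delta> div 2 ^ j) v W X" by metis
      qed
    qed
    then show "learn k D (2 * L * (2 ^ \<delta> div 2 ^ j)) v Y (?solved (2 ^ \<delta> div 2 ^ j) v W)"
    proof (rule learn_mono_time[OF _ _ hered k])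
      have "split_cost j \<delta> \<le> 2 * h * c"
        using div(1) h(1) by (simp add: split_cost_def)
      then have "L * split_cost j \<delta> \<le> L * (2 * h * c)" by (rule mult_le_mono2)
      then show "L * split_cost j \<delta> + h * (2 * L * c) \<le> 2 * L * (2 ^ \<delta> div 2 ^ j)"
        unfolding div(1) h(1) by (simp add: algebra_simps)
    qed
  qed
qed

text \<open>Preparation followed by solution: \<open>2 * L + 4 * L = 12 * (j + 1)\<close> for
  \<open>L = 2 * j + 2\<close>.\<close>

lemma learn_refine:
  assumes k: "k \<ge> 1" and "finite v" "card v \<le> 2 ^ \<delta>"
    and "W \<subseteq> v \<times> {1..k}" "tokens (2 ^ (j + 1) - 1) Y W" "blank_colour k Y v"
  shows "learn k \<infinity> (12 * (j + 1) * (2 ^ \<delta> div 2 ^ j)) v Y (\<lambda>Z. tokens (2 ^ j - 1) Z W)"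
proof -
  have "learn k \<infinity> (2 * (2 * j + 2) * (2 ^ \<delta> div 2 ^ j) + 4 * (2 * j + 2) * (2 ^ \<delta> div 2 ^ j)) v Y
      (\<lambda>Z. tokens (2 ^ j - 1) Z W)"
    by (rule learn_seq[OF learn_weaken[OF learn_prepare[OF assms] _ order.refl assms(2) k]]) auto
  then show ?thesis by (simp add: algebra_simps)
qed

section \<open>One block in linearly many queries\<close>

lemma learn_query:
  assumes "\<phi> \<in> diff_queries k U"
  shows "learn k \<infinity> 1 U X (\<lambda>Z. \<phi> constant_on Z)"
  unfolding One_nat_def
proof (rule learn_SucI[OF assms])
  show "learn k \<infinity> 0 U {x \<in> X. \<phi> x = a} (\<lambda>Z. \<phi> constant_on Z)" for a
    unfolding learn.simps by (rule constant_onI) simp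
qed simp

text \<open>An answer on \<open>U\<close> lies between \<open>- card U\<close> and
  \<open>card U\<close>. Thus any search on a small region can serve as the carried one.\<close>

lemma learn_narrow:
  assumes "learn k D t U X G" "2 * card U \<le> d"
  shows "learn k (enat d) t U X G"
  using assms(1)
proof (induction t arbitrary: X)
  case (Suc t)
  obtain \<phi> where *: "\<phi> \<in> diff_queries k U" "\<And>a. learn k D t U {x \<in> X. \<phi> x = a} G"
    using learn_SucE[OF Suc.prems(1)] by metis
  have "nat (\<phi> x - \<phi> y) \<le> d" for x y
    using diff_queries_bounded[OF *(1), of x] diff_queries_bounded[OF *(1), of y] assms(2) by linarith
  then show ?case
    by (intro learn_SucI[OF *(1)] Suc.IH[OF *(2)]) (simp only: enat_ord_simps)
qed simp

definition agree :: "nat set \<Rightarrow> code set \<Rightarrow> bool" where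
  "agree v Z \<longleftrightarrow> (\<forall>x\<in>Z. \<forall>y\<in>Z. \<forall>i\<in>v. x i = y i)"

lemma hereditary_agree: "hereditary (agree v)"
  unfolding hereditary_def agree_def by blast

text \<open>The cell \<open>(i, x i)\<close> lies in a token with a nonzero hit count, which for
  \<open>d = 0\<close> must consist of that cell alone. Its count is the same for \<open>y\<close>,
  so \<open>y i = x i\<close>.\<close>

lemma tokens_0_agree:
  assumes v: "finite v" and tok: "tokens 0 Z (v \<times> {1..k})"
    and Z: "\<And>x i. x \<in> Z \<Longrightarrow> i \<in> v \<Longrightarrow> x i \<in> {1..k}"
  shows "agree v Z"
  unfolding agree_def
proof (intro ballI)
  fix x y i assume x: "x \<in> Z" and y: "y \<in> Z" and i: "i \<in> v"
  obtain P where P: "\<Union>P = v \<times> {1..k}" "\<And>T. T \<in> P \<Longrightarrow> token 0 Z T"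
    using tok unfolding tokens_def by blast
  have "(i, x i) \<in> \<Union>P" unfolding P(1) using Z[OF x i] i by blast
  then obtain T where T: "T \<in> P" "(i, x i) \<in> T" by blast
  have fin: "finite T" using finite_cells[of T v k] T(1) P(1) v by blast
  have "hits T x \<noteq> 0" unfolding hits_def using T(2) fin by auto
  then have "card T \<le> 1" "hits T x = hits T y"
  proof -
    have "hits T constant_on Z" and *: "card T \<le> 1 \<or> (\<forall>x\<in>Z. hits T x \<le> 0)"
      using P(2)[OF T(1)] unfolding token_def by blast+
    then show "hits T x = hits T y" using x y by (auto dest: constant_onD)
    show "card T \<le> 1" using * x \<open>hits T x \<noteq> 0\<close> by auto
  qed
  moreover have T_eq: "T = {(i, x i)}"
    using card_le_Suc0_iff_eq[OF fin] \<open>card T \<le> 1\<close> T(2) by auto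
  ultimately have "hits {(i, x i)} y \<noteq> 0" using \<open>hits T x \<noteq> 0\<close> by simp
  then have "{p \<in> {(i, x i)}. y (fst p) = snd p} \<noteq> {}" unfolding hits_def by (metis card.empty)
  then show "x i = y i" by auto
qed

lemma learn_refine_all:
  assumes k: "k \<ge> 1" and v: "finite v" "card v \<le> 2 ^ \<delta>" and W: "W \<subseteq> v \<times> {1..k}"
    and "tokens (2 ^ J - 1) Y W" "blank_colour k Y v"
  shows "learn k \<infinity> (\<Sum>j<J. 12 * (j + 1) * (2 ^ \<delta> div 2 ^ j)) v Y (\<lambda>Z. tokens 0 Z W)"
  using assms(5,6)
proof (induction J arbitrary: Y)
  case (Suc J)
  have "learn k \<infinity> (12 * (J + 1) * (2 ^ \<delta> div 2 ^ J) + (\<Sum>j<J. 12 * (j + 1) * (2 ^ \<delta> div 2 ^ j))) v Y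
      (\<lambda>Z. tokens 0 Z W)"
  proof (rule learn_seq)
    show "learn k \<infinity> (12 * (J + 1) * (2 ^ \<delta> div 2 ^ J)) v Y (\<lambda>Z. tokens (2 ^ J - 1) Z W)"
      using Suc.prems by (intro learn_refine[OF k v W]) simp_all
    fix Z assume "Z \<subseteq> Y" "tokens (2 ^ J - 1) Z W"
    then show "learn k \<infinity> (\<Sum>j<J. 12 * (j + 1) * (2 ^ \<delta> div 2 ^ j)) v Z (\<lambda>Z. tokens 0 Z W)"
      using blank_colour_subset[OF Suc.prems(2) _ order.refl] by (intro Suc.IH)
  qed
  then show ?case unfolding sum.lessThan_Suc by (subst add.commute)
qed simp

text \<open>The series of the \<open>(j + 1) / 2 ^ j\<close> has sum 4, so all rounds together cost
  a constant times \<open>2 ^ \<delta>\<close>. The defect \<open>\<delta> + 3\<close> makes the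
  identity exact, as the induction requires.\<close>

lemma sum_halving: "(\<Sum>j<Suc \<delta>. (j + 1) * (2 ^ \<delta> div 2 ^ j)) + (\<delta> + 3) = 4 * (2::nat) ^ \<delta>"
proof (induction \<delta>)
  case (Suc \<delta>)
  have "(j + 1) * (2 ^ Suc \<delta> div 2 ^ j) = 2 * ((j + 1) * (2 ^ \<delta> div 2 ^ j))" if "j < Suc \<delta>" for j :: nat
  proof -
    have "(2::nat) ^ j dvd 2 ^ \<delta>" using that by (intro le_imp_power_dvd) simp
    then obtain m :: nat where m: "2 ^ \<delta> = 2 ^ j * m" by (rule dvdE)
    have "2 ^ Suc \<delta> = 2 ^ j * (2 * m)" using m by simp
    then show ?thesis using m by (simp del: power_Suc)
  qed
  then have "(\<Sum>j<Suc \<delta>. (j + 1) * (2 ^ Suc \<delta> div 2 ^ j)) = 2 * (\<Sum>j<Suc \<delta>. (j + 1) * (2 ^ \<delta> div 2 ^ j))"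
    unfolding sum_distrib_left by (intro sum.cong) auto
  moreover have "(\<Sum>j<Suc (Suc \<delta>). (j + 1) * (2 ^ Suc \<delta> div 2 ^ j))
      = (\<Sum>j<Suc \<delta>. (j + 1) * (2 ^ Suc \<delta> div 2 ^ j)) + (\<delta> + 2)" by simp
  ultimately show ?case using Suc by (simp del: sum.lessThan_Suc)
qed simp

lemma hits_column:
  assumes "finite v"
  shows "int (hits (v \<times> {c}) x) = (\<Sum>i\<in>v. of_bool (x i = c))"
proof -
  have "hits (v \<times> {c}) x = card {i \<in> v. x i = c}"
    unfolding hits_def
    by (rule bij_betw_same_card[of fst], rule bij_betw_byWitness[where f' = "\<lambda>i. (i, c)"]) auto
  then show ?thesis using assms by (simp add: sum_of_bool_eq Collect_conj_eq)
qed

lemma sum_hits_columns: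
  assumes "finite v" "\<And>i. i \<in> v \<Longrightarrow> x i \<in> {1..k}"
  shows "(\<Sum>c\<in>{1..k}. int (hits (v \<times> {c}) x)) = int (card v)"
proof -
  have "(\<Sum>c\<in>{1..k}. int (hits (v \<times> {c}) x)) = (\<Sum>i\<in>v. \<Sum>c\<in>{1..k}. of_bool (x i = c))"
    unfolding hits_column[OF assms(1)] by (rule sum.swap)
  also have "\<dots> = (\<Sum>i\<in>v. 1)"
    using assms(2) by (intro sum.cong refl) (simp add: of_bool_def)
  finally show ?thesis by simp
qed

text \<open>
  A region with fewer positions than colours has a blank colour, so no blank colour for the whole
  code is ever needed.
\<close>

lemma learn_block:
  assumes k: "k \<ge> 1" and v: "finite v" "card v < k"
    and Y: "\<And>x i. x \<in> Y \<Longrightarrow> i \<in> v \<Longrightarrow> x i \<in> {1..k}"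
  shows "learn k \<infinity> (97 * k) v Y (agree v)"
proof -
  obtain \<delta> where \<delta>: "card v \<le> 2 ^ \<delta>" "2 ^ \<delta> \<le> 2 * k"
  proof (cases "card v = 0")
    case True
    then show ?thesis using that[of 0] k by simp
  next
    case False
    then obtain e where "2 ^ e \<le> card v" "card v < 2 ^ (e + 1)"
      using ex_power_ivl1[of 2 "card v"] by auto
    then show ?thesis using that[of "e + 1"] v(2) by simp
  qed
  \<comment> \<open>Colour 1 is the reference, since no blank colour is known yet.\<close>
  define \<phi> :: "nat \<Rightarrow> code \<Rightarrow> int" where "\<phi> c x = (\<Sum>i\<in>v. of_bool (x i = c) - of_bool (x i = 1))" for c x
  have \<phi>_eq: "\<phi> c x = int (hits (v \<times> {c}) x) - int (hits (v \<times> {1}) x)" for c x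
    unfolding \<phi>_def hits_column[OF v(1)] by (simp add: sum_subtractf)
  have "learn k \<infinity> (card {1..k} * 1 + (\<Sum>j<Suc \<delta>. 12 * (j + 1) * (2 ^ \<delta> div 2 ^ j))) v Y (agree v)"
  proof (rule learn_seq[OF learn_all])
    show "learn k \<infinity> 1 v Y (\<lambda>Z. \<phi> c constant_on Z)" if "c \<in> {1..k}" for c
      unfolding \<phi>_def using that
      by (intro learn_query diff_queriesI[of "\<lambda>_. c" k "\<lambda>_. 1"]) auto
    fix Z assume ZY: "Z \<subseteq> Y" and const: "\<forall>c\<in>{1..k}. \<phi> c constant_on Z"
    have sum: "(\<Sum>c\<in>{1..k}. int (hits (v \<times> {c}) x)) = int (card v)" if "x \<in> Z" for x
      using sum_hits_columns[OF v(1)] Y ZY that by blast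
    have hits_const: "hits (v \<times> {c}) constant_on Z" if c: "c \<in> {1..k}" for c
    proof (rule constant_onI)
      fix x y assume xy: "x \<in> Z" "y \<in> Z"
      have eq: "\<phi> c x = \<phi> c y" if "c \<in> {1..k}" for c using constant_onD[OF _ xy] const that by blast
      \<comment> \<open>All counts sum to \<open>card v\<close>, so their differences to the count
        of colour 1 determine that count, and with it the others.\<close>
      have "(\<Sum>c\<in>{1..k}. \<phi> c z) = int (card v) - int k * int (hits (v \<times> {1}) z)" if "z \<in> Z" for z
        unfolding \<phi>_eq sum_subtractf sum[OF that] by simp
      moreover have "(\<Sum>c\<in>{1..k}. \<phi> c x) = (\<Sum>c\<in>{1..k}. \<phi> c y)"
        by (intro sum.cong refl eq)
      ultimately have "int k * int (hits (v \<times> {1}) x) = int k * int (hits (v \<times> {1}) y)"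
        using xy by force
      then show "hits (v \<times> {c}) x = hits (v \<times> {c}) y" using eq[OF c] k unfolding \<phi>_eq by simp
    qed
    have "blank_colour k Z v"
    proof (cases "Z = {}")
      case True
      then show ?thesis using k unfolding blank_colour_def by (intro bexI[of _ 1]) auto
    next
      case False
      then obtain x where x: "x \<in> Z" by blast
      \<comment> \<open>If every colour occurred, \<open>v\<close> would have at least
        \<open>k\<close> positions.\<close>
      have "\<exists>c\<in>{1..k}. hits (v \<times> {c}) x = 0"
      proof (rule ccontr)
        assume "\<not> ?thesis"
        then have "(\<Sum>c\<in>{1..k}. 1) \<le> (\<Sum>c\<in>{1..k}. int (hits (v \<times> {c}) x))"
          by (intro sum_mono) (simp add: Suc_le_eq int_one_le_iff_zero_less)
        then show False using sum[OF x] v(2) by simp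
      qed
      then obtain c where c: "c \<in> {1..k}" "hits (v \<times> {c}) x = 0" by blast
      have "y i \<noteq> c" if y: "y \<in> Z" "i \<in> v" for y i
      proof
        assume "y i = c"
        then have "(i, c) \<in> {p \<in> v \<times> {c}. y (fst p) = snd p}" using y by auto
        then have "hits (v \<times> {c}) y \<noteq> 0" unfolding hits_def using v(1) by auto
        then show False using constant_onD[OF hits_const[OF c(1)] x y(1)] c(2) by simp
      qed
      then show ?thesis using c(1) unfolding blank_colour_def by blast
    qed
    \<comment> \<open>The rounds start at \<open>Suc \<delta>\<close> because a colour may fill all
      of \<open>v\<close>, whose size may be exactly \<open>2 ^ \<delta>\<close>.\<close>
    moreover have "tokens (2 ^ Suc \<delta> - 1) Z (v \<times> {1..k})"
      unfolding tokens_def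
    proof (intro exI[of _ "(\<lambda>c. v \<times> {c}) ` {1..k}"] conjI ballI)
      fix T assume "T \<in> (\<lambda>c. v \<times> {c}) ` {1..k}"
      then obtain c where c: "c \<in> {1..k}" "T = v \<times> {c}" by blast
      have "(2::nat) ^ \<delta> \<le> 2 ^ Suc \<delta> - 1" by simp
      moreover have "hits T x \<le> card v" for x
        using c(2) v(1) by (intro hits_le_card) auto
      ultimately have "hits T x \<le> 2 ^ Suc \<delta> - 1" for x
        using \<delta>(1) by (meson le_trans)
      then show "token (2 ^ Suc \<delta> - 1) Z T"
        unfolding token_def using c hits_const[OF c(1)] by auto
    qed (auto simp: pairwise_def disjnt_def)
    ultimately have "learn k \<infinity> (\<Sum>j<Suc \<delta>. 12 * (j + 1) * (2 ^ \<delta> div 2 ^ j)) v Z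
        (\<lambda>Z. tokens 0 Z (v \<times> {1..k}))"
      using learn_refine_all[OF k v(1) \<delta>(1), of "v \<times> {1..k}" "Suc \<delta>" Z] by blast
    then show "learn k \<infinity> (\<Sum>j<Suc \<delta>. 12 * (j + 1) * (2 ^ \<delta> div 2 ^ j)) v Z (agree v)"
      by (rule learn_weaken[OF _ order.refl order.refl v(1) k])
        (use tokens_0_agree[OF v(1)] Y ZY in blast)
  qed (auto intro: hereditary_constant_on)
  then show ?thesis
  proof (rule learn_mono_time[OF _ _ hereditary_agree k])
    \<comment> \<open>The counts take \<open>k\<close> queries, and the rounds at most
      \<open>12 * 4 * 2 ^ \<delta>\<close>, hence at most \<open>96 * k\<close>.\<close>
    have "(\<Sum>j<Suc \<delta>. 12 * (j + 1) * (2 ^ \<delta> div 2 ^ j))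
        = 12 * (\<Sum>j<Suc \<delta>. (j + 1) * ((2::nat) ^ \<delta> div 2 ^ j))"
      unfolding sum_distrib_left by (simp only: mult.assoc)
    then show "card {1..k} * 1 + (\<Sum>j<Suc \<delta>. 12 * (j + 1) * (2 ^ \<delta> div 2 ^ j)) \<le> 97 * k"
      using sum_halving[of \<delta>] \<delta>(2) by (simp del: sum.lessThan_Suc)
  qed
qed

section \<open>Many blocks at once\<close>

text \<open>Greedy filling of \<open>h\<close> bins; values from \<open>h\<close> on mark the
  overflow.\<close>

lemma distribute_set:
  assumes "finite B" "card B \<le> h * a + c"
  obtains f :: "'b \<Rightarrow> nat" where "\<And>i. i < h \<Longrightarrow> card {b \<in> B. f b = i} \<le> a" "card {b \<in> B. h \<le> f b} \<le> c"
  using assms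
proof (induction h arbitrary: B thesis)
  case 0
  then show ?case using 0(1)[of "\<lambda>_. 0"] by simp
next
  case (Suc h)
  obtain S where S: "S \<subseteq> B" "card S = min (card B) a"
    using obtain_subset_with_card_n[of "min (card B) a" B] by auto
  have "card (B - S) = card B - card S" using S(1) Suc.prems(2) by (meson card_Diff_subset finite_subset)
  then have "card (B - S) \<le> h * a + c" using S(2) Suc.prems(3) by auto
  then obtain f where f: "\<And>i. i < h \<Longrightarrow> card {b \<in> B - S. f b = i} \<le> a" "card {b \<in> B - S. h \<le> f b} \<le> c"
    using Suc.IH[of "B - S"] Suc.prems(2) by blast
  define g where "g b = (if b \<in> S then 0 else Suc (f b))" for b
  show ?case
  proof (rule Suc.prems(1)[of g])
    fix i assume i: "i < Suc h"
    show "card {b \<in> B. g b = i} \<le> a"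
    proof (cases i)
      case 0
      then have "{b \<in> B. g b = i} = S" using S(1) by (auto simp: g_def)
      then show ?thesis using S(2) by simp
    next
      case (Suc i')
      then have "{b \<in> B. g b = i} = {b \<in> B - S. f b = i'}" by (auto simp: g_def)
      then show ?thesis using f(1)[of i'] Suc i by simp
    qed
  next
    have "{b \<in> B. Suc h \<le> g b} = {b \<in> B - S. h \<le> f b}" by (auto simp: g_def)
    then show "card {b \<in> B. Suc h \<le> g b} \<le> c" using f(2) by simp
  qed
qed

text \<open>With \<open>h = 2 ^ (2 * j + 1)\<close>, let \<open>N L\<close> be the number of blocks
  treated at depth \<open>L\<close> by \<open>h ^ L * q\<close> queries. Depth \<open>L + 1\<close>
  runs \<open>h\<close> groups of depth \<open>L\<close> in parallel and carries further blocks for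
  free, so \<open>N (L + 1) = h * N L + h ^ L * 2 ^ (2 * j)\<close>. With \<open>N 0 = 1\<close>
  this gives \<open>N L = h ^ L * (L + 2) / 2\<close>. The bound on the block size makes
  \<open>learn_narrow\<close> applicable to the carried blocks.\<close>

lemma learn_many:
  fixes V :: "'b \<Rightarrow> nat set"
  assumes k: "k \<ge> 1" and "finite B" "disjoint_family_on V B"
    and "\<And>b. b \<in> B \<Longrightarrow> finite (V b)" "\<And>b. b \<in> B \<Longrightarrow> 2 * card (V b) \<le> 2 ^ (j + 1) - 1"
    and "\<And>b. b \<in> B \<Longrightarrow> learn k \<infinity> q (V b) Y (G b)" and G: "\<And>b. b \<in> B \<Longrightarrow> hereditary (G b)"
    and "2 * card B \<le> (2 ^ (2 * j + 1)) ^ L * (L + 2)"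
  shows "learn k \<infinity> ((2 ^ (2 * j + 1)) ^ L * q) (\<Union>b\<in>B. V b) Y (\<lambda>Z. \<forall>b\<in>B. G b Z)"
  using assms(2-)
proof (induction L arbitrary: B)
  case 0
  then have "card B \<le> 1" by simp
  then consider "B = {}" | b where "B = {b}"
    using 0(1) by (metis One_nat_def card_1_singletonE card_0_eq le_Suc_eq le_zero_eq)
  then show ?case
  proof cases
    case 1
    have "learn k \<infinity> q {} Y (\<lambda>Z. True)"
      by (rule learn_mono_time[of _ _ 0]) (use k in \<open>auto simp: hereditary_def\<close>)
    then show ?thesis using 1 by simp
  qed (use 0 in simp)
next
  case (Suc L)
  define h :: nat where "h = 2 ^ (2 * j + 1)"
  define a where "a = h ^ L * (L + 2) div 2"
  have h: "h = 2 * 2 ^ (2 * j)" by (simp add: h_def)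
  have a: "2 * a = h ^ L * (L + 2)"
    unfolding a_def h by (cases L) auto
  have "2 * (h * a + h ^ L * 2 ^ (2 * j)) = h * (2 * a) + h ^ L * h"
    unfolding h by (simp add: algebra_simps)
  also have "\<dots> = h ^ Suc L * (Suc L + 2)" unfolding a by (simp add: algebra_simps)
  finally have "2 * card B \<le> 2 * (h * a + h ^ L * 2 ^ (2 * j))"
    using Suc.prems(7) unfolding h_def[symmetric] by (simp only:)
  then have "card B \<le> h * a + h ^ L * 2 ^ (2 * j)" by (rule mult_left_le_imp_le) simp
  then obtain f :: "'b \<Rightarrow> nat" where f: "\<And>i. i < h \<Longrightarrow> card {b \<in> B. f b = i} \<le> a"
    "card {b \<in> B. h \<le> f b} \<le> h ^ L * 2 ^ (2 * j)"
    using distribute_set[OF Suc.prems(1)] by blast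
  \<comment> \<open>The overflow: these blocks are carried, one after another.\<close>
  define C where "C = {b \<in> B. h \<le> f b}"
  define U where "U i = (\<Union>b\<in>{b \<in> B. f b = i}. V b)" for i
  define X where "X = (\<Union>b\<in>C. V b)"
  have finC: "finite C" "C \<subseteq> B" using Suc.prems(1) by (auto simp: C_def)
  have parallel: "learn k \<infinity> (h ^ L * q * 2 ^ (2 * j + 1)) ((\<Union>i\<in>{..<h}. U i) \<union> X) Y
      (\<lambda>Z. (\<forall>i\<in>{..<h}. \<forall>b\<in>{b \<in> B. f b = i}. G b Z) \<and> (\<forall>b\<in>C. G b Z))"
  proof (rule learn_parallel[OF k])
    show "learn k \<infinity> (h ^ L * q) (U i) Y (\<lambda>Z. \<forall>b\<in>{b \<in> B. f b = i}. G b Z)" if i: "i \<in> {..<h}" for i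
      unfolding U_def h_def
    proof (rule Suc.IH)
      have "2 * card {b \<in> B. f b = i} \<le> h ^ L * (L + 2)" using f(1)[of i] i a by simp
      then show "2 * card {b \<in> B. f b = i} \<le> (2 ^ (2 * j + 1)) ^ L * (L + 2)" unfolding h_def .
    qed (use Suc.prems in \<open>auto simp: disjoint_family_on_def\<close>)
    have "learn k (2 ^ (j + 1) - 1 :: nat) (card C * q) X Y (\<lambda>Z. \<forall>b\<in>C. G b Z)"
    proof (rule learn_all[OF finC(1)])
      fix b assume b: "b \<in> C"
      then have bB: "b \<in> B" using finC by blast
      show "hereditary (G b)" using Suc.prems(6)[OF bB] .
      have "learn k (2 ^ (j + 1) - 1 :: nat) q (V b) Y (G b)"
        by (rule learn_narrow[OF Suc.prems(5)[OF bB] Suc.prems(4)[OF bB]])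
      then show "learn k (2 ^ (j + 1) - 1 :: nat) q X Y (G b)"
        by (rule learn_weaken[OF _ order.refl _ _ k]) (use b finC Suc.prems(3) in \<open>auto simp: X_def\<close>)
    qed
    then show "learn k (2 ^ (j + 1) - 1 :: nat) (h ^ L * q * 2 ^ (2 * j)) X Y (\<lambda>Z. \<forall>b\<in>C. G b Z)"
    proof (rule learn_mono_time[OF _ _ _ k])
      show "card C * q \<le> h ^ L * q * 2 ^ (2 * j)"
        using mult_le_mono1[OF f(2)[folded C_def], of q] by (simp add: algebra_simps)
    qed (use finC Suc.prems(6) in \<open>auto intro!: hereditary_ball\<close>)
    show "disjoint_family_on U {..<h}"
      unfolding disjoint_family_on_def
    proof (intro ballI impI)
      fix i i' :: nat assume "i \<noteq> i'"
      then have "V b \<inter> V b' = {}" if "b \<in> B" "f b = i" "b' \<in> B" "f b' = i'" for b b'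
        using disjoint_family_onD[OF Suc.prems(2), of b b'] that by blast
      then show "U i \<inter> U i' = {}" unfolding U_def by blast
    qed
    show "U i \<inter> X = {}" if i: "i \<in> {..<h}" for i
    proof -
      have "V b \<inter> V b' = {}" if "b \<in> B" "f b = i" "b' \<in> B" "h \<le> f b'" for b b'
        using disjoint_family_onD[OF Suc.prems(2), of b b'] that i by force
      then show ?thesis unfolding U_def X_def C_def by blast
    qed
    show "hereditary (\<lambda>Z. \<forall>b\<in>{b \<in> B. f b = i}. G b Z)" for i
      using Suc.prems(6) by (intro hereditary_ball) blast
    show "hereditary (\<lambda>Z. \<forall>b\<in>C. G b Z)"
      using Suc.prems(6) finC(2) by (intro hereditary_ball) blast
  qed (use Suc.prems finC in \<open>auto simp: h_def U_def X_def\<close>)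
  have union: "(\<Union>i\<in>{..<h}. U i) \<union> X = (\<Union>b\<in>B. V b)"
  proof
    show "(\<Union>i\<in>{..<h}. U i) \<union> X \<subseteq> (\<Union>b\<in>B. V b)" unfolding U_def X_def C_def by blast
    show "(\<Union>b\<in>B. V b) \<subseteq> (\<Union>i\<in>{..<h}. U i) \<union> X"
    proof
      fix p assume "p \<in> (\<Union>b\<in>B. V b)"
      then obtain b where "b \<in> B" "p \<in> V b" by blast
      then show "p \<in> (\<Union>i\<in>{..<h}. U i) \<union> X"
        unfolding U_def X_def C_def by (cases "f b < h") auto
    qed
  qed
  have ball: "(\<forall>i\<in>{..<h}. \<forall>b\<in>{b \<in> B. f b = i}. G b Z) \<and> (\<forall>b\<in>C. G b Z) \<longleftrightarrow> (\<forall>b\<in>B. G b Z)" for Z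
  proof (intro iffI ballI)
    fix b assume "(\<forall>i\<in>{..<h}. \<forall>b\<in>{b \<in> B. f b = i}. G b Z) \<and> (\<forall>b\<in>C. G b Z)" "b \<in> B"
    then show "G b Z" unfolding C_def by (cases "f b < h") auto
  qed (auto simp: C_def)
  have "h ^ L * q * 2 ^ (2 * j + 1) = h ^ Suc L * q"
    unfolding h_def by (simp add: algebra_simps)
  then show ?case
    using parallel unfolding h_def[symmetric] union ball by metis
qed

text \<open>Blocks of \<open>k - 1\<close> positions are the largest that \<open>learn_block\<close>
  admits, and \<open>k \<le> 2 ^ j\<close> makes their answers narrow enough to be carried. They are
  solved in batches of \<open>a div 2\<close>, the capacity of \<open>learn_many\<close>.\<close>

lemma learn_code:
  fixes k j L n :: nat
  assumes k: "k \<ge> 2" and j: "k \<le> 2 ^ j"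
  defines "a \<equiv> (2 ^ (2 * j + 1)) ^ L * (L + 2)"
  shows "learn k \<infinity> ((2 * (n div (k - 1) + 1) div a + 1) * ((2 ^ (2 * j + 1)) ^ L * (97 * k)))
    {1..n} (codewords n k) (agree {1..n})"
proof -
  define s where "s = k - 1"
  \<comment> \<open>If \<open>s\<close> divides \<open>n\<close>, the last block is empty, which
    does no harm.\<close>
  define g where "g = n div s + 1"
  have s: "s \<ge> 1" "s < k" using k by (auto simp: s_def)
  define V where "V b = {i \<in> {1..n}. (i - 1) div s = b}" for b
  have V_union: "(\<Union>b\<in>{..<g}. V b) = {1..n}"
  proof -
    have "(i - 1) div s < g" if "i \<in> {1..n}" for i
    proof -
      have "i - 1 \<le> n" using that by auto
      then show ?thesis using div_le_mono[of "i - 1" n s] by (simp add: g_def)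
    qed
    then show ?thesis by (auto simp: V_def)
  qed
  have V_card: "card (V b) \<le> s" for b
  proof -
    have "V b \<subseteq> {b * s + 1..b * s + s}"
    proof
      fix i assume "i \<in> V b"
      then have i: "i \<ge> 1" "(i - 1) div s = b" by (auto simp: V_def)
      have "b * s \<le> i - 1" unfolding i(2)[symmetric] by simp
      moreover have "i - 1 < b * s + s" unfolding i(2)[symmetric] using s(1) dividend_less_div_times[of s "i - 1"] by linarith
      ultimately show "i \<in> {b * s + 1..b * s + s}" using i(1) by auto
    qed
    from card_mono[OF _ this] show ?thesis by simp
  qed
  have V_fin: "finite (V b)" and V_disj: "disjoint_family_on V B" for b B
    by (auto simp: V_def disjoint_family_on_def)
  have block: "learn k \<infinity> (97 * k) (V b) (codewords n k) (agree (V b))" for b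
    using k s V_card[of b] V_fin
    by (intro learn_block) (auto simp: codewords_def V_def PiE_def Pi_def)
  have a: "a > 0" "even a" unfolding a_def by (cases L; simp)+
  \<comment> \<open>\<open>r\<close> batches have room for all \<open>g\<close> blocks, so the
    overflow of \<open>distribute_set\<close> is empty.\<close>
  define r where "r = 2 * g div a + 1"
  have "2 * g \<le> r * a" using a(1) by (simp add: r_def) (metis add.commute div_mult_mod_eq add_le_cancel_left mod_less_divisor less_imp_le)
  then have "card {..<g} \<le> r * (a div 2) + 0" using a(2) by auto
  then obtain f :: "nat \<Rightarrow> nat" where f: "\<And>i. i < r \<Longrightarrow> card {b \<in> {..<g}. f b = i} \<le> a div 2"
    "card {b \<in> {..<g}. r \<le> f b} \<le> 0"
    using distribute_set[OF finite_lessThan] by blast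
  have f_less: "f b < r" if "b < g" for b
    using f(2) that by (auto simp: not_le)
  let ?t = "(2 ^ (2 * j + 1)) ^ L * (97 * k)"
  have "learn k \<infinity> (card {..<r} * ?t) {1..n} (codewords n k)
      (\<lambda>Z. \<forall>i\<in>{..<r}. \<forall>b\<in>{b \<in> {..<g}. f b = i}. agree (V b) Z)"
  proof (rule learn_all)
    fix i assume i: "i \<in> {..<r}"
    have "learn k \<infinity> ?t (\<Union>b\<in>{b \<in> {..<g}. f b = i}. V b) (codewords n k)
        (\<lambda>Z. \<forall>b\<in>{b \<in> {..<g}. f b = i}. agree (V b) Z)"
    proof (rule learn_many[OF _ _ V_disj V_fin _ block])
      show "2 * card {b \<in> {..<g}. f b = i} \<le> (2 ^ (2 * j + 1)) ^ L * (L + 2)"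
        using f(1)[of i] i a(2) unfolding a_def[symmetric] by auto
      show "2 * card (V b) \<le> 2 ^ (j + 1) - 1" for b
        using V_card[of b] s(2) j by simp
    qed (use k in \<open>auto intro: hereditary_agree\<close>)
    then show "learn k \<infinity> ?t {1..n} (codewords n k) (\<lambda>Z. \<forall>b\<in>{b \<in> {..<g}. f b = i}. agree (V b) Z)"
      by (rule learn_weaken[OF _ order.refl]) (use k in \<open>auto simp: V_def\<close>)
    show "hereditary (\<lambda>Z. \<forall>b\<in>{b \<in> {..<g}. f b = i}. agree (V b) Z)"
      by (intro hereditary_ball hereditary_agree)
  qed simp
  then have "learn k \<infinity> (card {..<r} * ?t) {1..n} (codewords n k) (agree {1..n})"
  proof (rule learn_weaken[OF _ order.refl order.refl])
    fix Z assume *: "\<forall>i\<in>{..<r}. \<forall>b\<in>{b \<in> {..<g}. f b = i}. agree (V b) Z"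
    have "agree (V b) Z" if "b < g" for b using * f_less[OF that] that by auto
    then show "agree {1..n} Z" unfolding V_union[symmetric] agree_def by blast
  qed (use k in auto)
  then show ?thesis unfolding r_def g_def s_def by simp
qed

section \<open>From learning to strategies\<close>

text \<open>The counterpart of \<open>learn\<close> for genuine queries, with the goal that at most
  one candidate is left.\<close>

primrec decide :: "nat \<Rightarrow> nat \<Rightarrow> nat \<Rightarrow> code set \<Rightarrow> bool" where
  "decide n k 0 X = (\<forall>x\<in>X. \<forall>y\<in>X. x = y)"
| "decide n k (Suc t) X = (\<exists>q\<in>codewords n k. \<forall>a. decide n k t {x \<in> X. black_pegs n x q = a})"

lemma decide_subset: "decide n k t X \<Longrightarrow> Y \<subseteq> X \<Longrightarrow> decide n k t Y"
proof (induction t arbitrary: X Y)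
  case (Suc t)
  then obtain q where q: "q \<in> codewords n k" "\<And>a. decide n k t {x \<in> X. black_pegs n x q = a}" by auto
  have "decide n k t {x \<in> Y. black_pegs n x q = a}" for a
    using Suc.prems(2) by (intro Suc.IH[OF q(2)[of a]]) auto
  then show ?case using q(1) by auto
qed auto

lemma int_black_pegs: "int (black_pegs n x q) = (\<Sum>i\<in>{1..n}. of_bool (x i = q i))"
proof -
  have "{i \<in> {1..n}. x i = q i} = {1..n} \<inter> {i. x i = q i}" by blast
  then show ?thesis unfolding black_pegs_def by (simp only: sum_of_bool_eq finite_atLeastAtMost)
qed

text \<open>A difference query costs two genuine queries, whose pair of answers says at least as
  much as their difference.\<close>

lemma decide_if_learn:
  assumes "learn k D t {1..n} X G" "\<And>Z. Z \<subseteq> X \<Longrightarrow> G Z \<Longrightarrow> decide n k 0 Z"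
  shows "decide n k (2 * t) X"
  using assms
proof (induction t arbitrary: X)
  case (Suc t)
  obtain \<phi> where \<phi>: "\<phi> \<in> diff_queries k {1..n}" "\<And>a. learn k D t {1..n} {x \<in> X. \<phi> x = a} G"
    using learn_SucE[OF Suc.prems(1)] by metis
  obtain p q where pq: "range p \<subseteq> {1..k}" "range q \<subseteq> {1..k}"
    "\<phi> = (\<lambda>x. \<Sum>i\<in>{1..n}. of_bool (x i = p i) - of_bool (x i = q i))"
    using diff_queriesE[OF \<phi>(1)] .
  define p' q' where "p' = restrict p {1..n}" and "q' = restrict q {1..n}"
  have mem: "p' \<in> codewords n k" "q' \<in> codewords n k"
    using pq(1,2) unfolding p'_def q'_def codewords_def by (auto simp: image_subset_iff)
  have eq: "\<phi> x = int (black_pegs n x p') - int (black_pegs n x q')" for x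
    unfolding pq(3) int_black_pegs p'_def q'_def by (simp add: sum_subtractf)
  have IH: "decide n k (2 * t) {x \<in> X. \<phi> x = a}" for a
    using Suc.prems(2) by (intro Suc.IH[OF \<phi>(2)]) auto
  have "decide n k (2 * t) {x \<in> {x \<in> X. black_pegs n x p' = a}. black_pegs n x q' = b}" for a b
    by (rule decide_subset[OF IH[of "int a - int b"]]) (auto simp: eq)
  then have "decide n k (Suc (Suc (2 * t))) X" using mem by auto
  then show ?case by simp
next
  case 0
  then show ?case by (metis learn.simps(1) mult_0_right subset_refl)
qed

definition candidates :: "nat \<Rightarrow> nat \<Rightarrow> history \<Rightarrow> code set" where
  "candidates n k h = {x \<in> codewords n k. \<forall>(q, a)\<in>set h. black_pegs n x q = a}"

lemma length_play: "length (play n \<sigma> x t) = t"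
  by (induction t) (auto simp: Let_def)

lemma candidates_play: "x \<in> codewords n k \<Longrightarrow> x \<in> candidates n k (play n \<sigma> x t)"
  unfolding candidates_def by (induction t) (auto simp: Let_def)

text \<open>The remaining candidates and the number of queries left can be read off the history, so
  a query that keeps the candidates decidable in the time left can be chosen as a function of the
  history.\<close>

lemma solvable_within_if_decide:
  assumes "decide n k T (codewords n k)" "k \<ge> 1"
  shows "solvable_within n k T"
proof -
  have "codewords n k \<noteq> {}" using assms(2) unfolding codewords_def by (simp add: PiE_eq_empty_iff)
  then obtain z where z: "z \<in> codewords n k" by blast
  define good where "good h q \<longleftrightarrow> q \<in> codewords n k \<and>
    (\<forall>a. decide n k (T - Suc (length h)) {x \<in> candidates n k h. black_pegs n x q = a})" for h q
  \<comment> \<open>A strategy must respond to every history with a codeword; \<open>z\<close>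
    serves those without a good query.\<close>
  define \<sigma> where "\<sigma> h = (if \<exists>q. good h q then SOME q. good h q else z)" for h
  have good: "good h (\<sigma> h)" if "\<exists>q. good h q" for h
    using that someI_ex[OF that] by (simp add: \<sigma>_def)
  have "\<sigma> h \<in> codewords n k" for h
    using good[of h] z by (cases "\<exists>q. good h q") (auto simp: good_def \<sigma>_def)
  then have strat: "strategy n k \<sigma>" unfolding strategy_def by blast
  have inv: "decide n k (T - t) (candidates n k (play n \<sigma> x t))" if "t \<le> T" for x t
    using that
  proof (induction t)
    case 0
    then show ?case using assms(1) by (simp add: candidates_def)
  next
    case (Suc t)
    let ?h = "play n \<sigma> x t"
    have "T - t = Suc (T - Suc t)" using Suc.prems by simp
    then have "\<exists>q. good ?h q"
      using Suc unfolding good_def length_play by auto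
    then have "decide n k (T - Suc t) {y \<in> candidates n k ?h. black_pegs n y (\<sigma> ?h) = black_pegs n x (\<sigma> ?h)}"
      using good[of ?h] unfolding good_def length_play by blast
    moreover have "candidates n k (play n \<sigma> x (Suc t))
        = {y \<in> candidates n k ?h. black_pegs n y (\<sigma> ?h) = black_pegs n x (\<sigma> ?h)}"
      by (auto simp: candidates_def Let_def)
    ultimately show ?case by simp
  qed
  have "solved n k x (play n \<sigma> x T)" if x: "x \<in> codewords n k" for x
    unfolding solved_def
  proof (intro ballI impI)
    fix y assume y: "y \<in> codewords n k" "y \<noteq> x"
    have "y \<notin> candidates n k (play n \<sigma> x T)"
      using inv[of T x] candidates_play[OF x, of \<sigma> T] y(2) by auto
    then show "\<exists>(q, a)\<in>set (play n \<sigma> x T). black_pegs n y q \<noteq> a"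
      using y(1) unfolding candidates_def by auto
  qed
  then show ?thesis unfolding solvable_within_def using strat by blast
qed

lemma min_queries_le_learn:
  assumes "learn k D t {1..n} (codewords n k) (agree {1..n})" "k \<ge> 1"
  shows "min_queries n k \<le> 2 * t"
proof -
  have "decide n k (2 * t) (codewords n k)"
  proof (rule decide_if_learn[OF assms(1)])
    fix Z assume "Z \<subseteq> codewords n k" "agree {1..n} Z"
    then have "x = y" if "x \<in> Z" "y \<in> Z" for x y
      using that unfolding agree_def codewords_def by (intro PiE_ext[of x "{1..n}" "\<lambda>_. {1..k}" y]) blast+
    then show "decide n k 0 Z" by simp
  qed
  then have "solvable_within n k (2 * t)" using assms(2) by (rule solvable_within_if_decide)
  then show ?thesis unfolding min_queries_def by (rule Least_le)
qed

lemma solvable_within_min_queries: "k \<ge> 1 \<Longrightarrow> solvable_within n k (min_queries n k)"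
  unfolding min_queries_def by (rule LeastI_ex[OF solvable_within_exists])

section \<open>Bounds\<close>

lemma set_play_mono: "t \<le> t' \<Longrightarrow> set (play n \<sigma> x t) \<subseteq> set (play n \<sigma> x t')"
proof (induction rule: dec_induct)
  case (step t')
  then show ?case unfolding play.simps Let_def by (simp add: subset_insertI2)
qed simp

lemma play_answers: "(q, a) \<in> set (play n \<sigma> x t) \<Longrightarrow> a = black_pegs n x q"
  by (induction t) (auto simp: Let_def)

lemma play_eqI: "map snd (play n \<sigma> x t) = map snd (play n \<sigma> y t) \<Longrightarrow> play n \<sigma> x t = play n \<sigma> y t"
proof (induction t)
  case (Suc t)
  then have "map snd (play n \<sigma> x t) = map snd (play n \<sigma> y t)"
    "black_pegs n x (\<sigma> (play n \<sigma> x t)) = black_pegs n y (\<sigma> (play n \<sigma> y t))"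
    by (simp_all add: Let_def)
  then show ?case using Suc.IH by (simp add: Let_def)
qed simp

text \<open>Two codewords with equal answers share the whole play, since each query depends on
  earlier answers only; so no part of it can rule out one of them in favour of the other.\<close>

lemma inj_on_answers:
  assumes "\<forall>x\<in>codewords n k. \<exists>t\<le>T. solved n k x (play n \<sigma> x t)"
  shows "inj_on (\<lambda>x. map snd (play n \<sigma> x T)) (codewords n k)"
proof (rule inj_onI, rule ccontr)
  fix x y assume xy: "x \<in> codewords n k" "y \<in> codewords n k" "x \<noteq> y"
    and "map snd (play n \<sigma> x T) = map snd (play n \<sigma> y T)"
  then have eq: "play n \<sigma> x T = play n \<sigma> y T" by (intro play_eqI)
  obtain t where t: "t \<le> T" "solved n k x (play n \<sigma> x t)" using assms xy(1) by blast
  then have "\<exists>p\<in>set (play n \<sigma> x t). case p of (q, a) \<Rightarrow> black_pegs n y q \<noteq> a"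
    using xy(2) xy(3)[symmetric] unfolding solved_def by blast
  then obtain q a where qa: "(q, a) \<in> set (play n \<sigma> x t)" "black_pegs n y q \<noteq> a"
    by (auto split: prod.splits)
  then have "(q, a) \<in> set (play n \<sigma> y T)" using set_play_mono[OF t(1), of n \<sigma> x] eq by auto
  then show False using play_answers qa(2) by blast
qed

text \<open>A strategy separates at most as many codewords as there are answer sequences, and each
  answer is one of \<open>n + 1\<close> values.\<close>

lemma counting_bound:
  assumes "solvable_within n k T"
  shows "k ^ n \<le> (n + 1) ^ T"
proof -
  obtain \<sigma> where \<sigma>: "\<forall>x\<in>codewords n k. \<exists>t\<le>T. solved n k x (play n \<sigma> x t)"
    using assms unfolding solvable_within_def by blast
  let ?L = "{xs. set xs \<subseteq> {0..n} \<and> length xs = T}"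
  have "black_pegs n x q \<le> n" for x q
  proof -
    have "card {i \<in> {1..n}. x i = q i} \<le> card {1..n}" by (intro card_mono) auto
    then show ?thesis unfolding black_pegs_def by simp
  qed
  then have "set (map snd (play n \<sigma> x t)) \<subseteq> {0..n}" for x t
    by (induction t) (auto simp: Let_def)
  then have "(\<lambda>x. map snd (play n \<sigma> x T)) ` codewords n k \<subseteq> ?L"
    by (intro image_subsetI CollectI conjI) (simp_all add: length_play)
  then have "card (codewords n k) \<le> card ?L"
    by (rule card_inj_on_le[OF inj_on_answers[OF \<sigma>]]) (simp add: finite_lists_length_eq)
  then show ?thesis
    by (simp add: codewords_def card_PiE card_lists_length_eq)
qed

text \<open>
  As long as the answers are zero, a query removes at most one colour from each position.
\<close>

lemma colour_bound:
  assumes "solvable_within n k T" "n \<ge> 1"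
  shows "k \<le> T + 1"
proof (rule ccontr)
  assume less: "\<not> k \<le> T + 1"
  obtain \<sigma> where \<sigma>: "\<forall>x\<in>codewords n k. \<exists>t\<le>T. solved n k x (play n \<sigma> x t)"
    using assms unfolding solvable_within_def by blast
  \<comment> \<open>\<open>z t\<close> is the history after \<open>t\<close> answers of zero;
    \<open>free i\<close> will hold the colours that its first \<open>T\<close> queries never ask at
    position \<open>i\<close>.\<close>
  define z :: "nat \<Rightarrow> history" where "z = rec_nat [] (\<lambda>_ h. h @ [(\<sigma> h, 0)])"
  have z: "z 0 = []" "z (Suc t) = z t @ [(\<sigma> (z t), 0)]" for t by (simp_all add: z_def)
  define free where "free i = {1..k} - (\<lambda>t. \<sigma> (z t) i) ` {..<T}" for i
  \<comment> \<open>\<open>T\<close> queries exclude at most \<open>T\<close> of at least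
    \<open>T + 2\<close> colours.\<close>
  have two: "\<exists>a\<in>free i. \<exists>b\<in>free i. a \<noteq> b" for i
  proof -
    have "card {1..k} - card ((\<lambda>t. \<sigma> (z t) i) ` {..<T}) \<le> card (free i)"
      unfolding free_def by (rule diff_card_le_card_Diff) simp
    moreover have "card ((\<lambda>t. \<sigma> (z t) i) ` {..<T}) \<le> T"
      using card_image_le[of "{..<T}" "\<lambda>t. \<sigma> (z t) i"] by simp
    ultimately have "\<not> card (free i) \<le> Suc 0" using less by simp
    moreover have "finite (free i)" by (simp add: free_def)
    ultimately show ?thesis by (simp add: card_le_Suc0_iff_eq)
  qed
  have "\<exists>f. \<forall>i. f i \<in> free i \<and> (\<exists>b\<in>free i. f i \<noteq> b)"
    by (rule choice, rule allI) (use two in blast)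
  then obtain f where f: "\<forall>i. f i \<in> free i \<and> (\<exists>b\<in>free i. f i \<noteq> b)" by (rule exE)
  have "\<exists>g. \<forall>i. g i \<in> free i \<and> f i \<noteq> g i"
    by (rule choice, rule allI) (use f in blast)
  then obtain g where g: "\<forall>i. g i \<in> free i \<and> f i \<noteq> g i" by (rule exE)
  have fg: "f i \<in> free i" "g i \<in> free i" "f i \<noteq> g i" for i using f g by blast+
  \<comment> \<open>A codeword made of free colours receives only zero answers, so \<open>f\<close>
    and \<open>g\<close> are not told apart although they differ at position 1.\<close>
  have play: "play n \<sigma> (restrict e {1..n}) t = z t" if e: "\<And>i. e i \<in> free i" and t: "t \<le> T" for e t
    using t
  proof (induction t)
    case (Suc t)
    have "e i \<noteq> \<sigma> (z t) i" for i using e[of i] Suc.prems unfolding free_def by auto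
    then have "{i \<in> {1..n}. restrict e {1..n} i = \<sigma> (z t) i} = {}" by auto
    then have "black_pegs n (restrict e {1..n}) (\<sigma> (z t)) = 0" unfolding black_pegs_def by (simp only: card.empty)
    moreover have "play n \<sigma> (restrict e {1..n}) t = z t"
      using Suc.prems by (intro Suc.IH) linarith
    ultimately show ?case unfolding play.simps Let_def z by simp
  qed (simp add: z)
  have "restrict f {1..n} \<in> codewords n k" "restrict g {1..n} \<in> codewords n k"
    using fg(1,2) unfolding codewords_def free_def by auto
  moreover have "map snd (play n \<sigma> (restrict f {1..n}) T) = map snd (play n \<sigma> (restrict g {1..n}) T)"
    unfolding play[OF fg(1) order.refl] play[OF fg(2) order.refl] ..
  ultimately have "restrict f {1..n} = restrict g {1..n}"
    by (intro inj_onD[OF inj_on_answers[OF \<sigma>]])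
  then have "restrict f {1..n} 1 = restrict g {1..n} 1" by (rule arg_cong)
  then have "f 1 = g 1" using assms(2) by simp
  then show False using fg(3) by blast
qed

text \<open>Each of the two terms is at most twice the number of queries:
  \<open>colour_bound\<close> with \<open>k \<ge> 2\<close> gives one, and
  \<open>n + 1 \<le> n ^ 2\<close> turns the \<open>ln (n + 1)\<close> of the counting bound into
  \<open>2 * ln n\<close>.\<close>

lemma min_queries_ge:
  assumes "n \<ge> 2" "k \<ge> 2"
  shows "1 / 4 * (real n * (ln (real k) / ln (real n)) + real k) \<le> real (min_queries n k)"
proof -
  let ?T = "min_queries n k"
  have sol: "solvable_within n k ?T" using assms by (intro solvable_within_min_queries) simp
  have k: "real k \<le> 2 * real ?T" using colour_bound[OF sol] assms by simp
  have n: "ln (real n) > 0" "ln (real n + 1) > 0" using assms by simp_all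
  have "real k ^ n \<le> (real n + 1) ^ ?T"
  proof -
    have "real (k ^ n) \<le> real ((n + 1) ^ ?T)" using counting_bound[OF sol] by (rule of_nat_mono)
    then show ?thesis unfolding of_nat_power of_nat_add of_nat_1 .
  qed
  then have "ln (real k ^ n) \<le> ln ((real n + 1) ^ ?T)" using assms by (subst ln_le_cancel_iff) auto
  then have "real n * ln (real k) \<le> real ?T * ln (real n + 1)"
    using assms by (simp add: ln_realpow)
  also have "ln (real n + 1) \<le> ln (real n ^ 2)"
  proof (subst ln_le_cancel_iff)
    have "real n * 2 \<le> real n * real n" using assms by (intro mult_left_mono) auto
    then show "real n + 1 \<le> real n ^ 2" using assms unfolding power2_eq_square by linarith
  qed (use assms in auto)
  also have "ln (real n ^ 2) = 2 * ln (real n)" using assms by (simp add: ln_realpow)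
  finally have "real n * ln (real k) \<le> real ?T * (2 * ln (real n))" by (simp add: mult_left_mono)
  then have "real n * (ln (real k) / ln (real n)) \<le> 2 * real ?T"
    using n by (simp add: field_simps)
  moreover have "1 / 4 * (a + b) \<le> c" if "a \<le> 2 * c" "b \<le> 2 * c" for a b c :: real
    using that by (simp add: field_simps)
  ultimately show ?thesis using k by blast
qed

section \<open>Upper bound and choice of the nesting depth\<close>

lemma min_queries_le:
  assumes "n \<ge> 2" "k \<ge> 2"
  shows "real (min_queries n k) \<le> 10000 * (real n * (ln (real k) / ln (real n)) + real k)"
proof -
  \<comment> \<open>\<open>l\<close> is the logarithm of \<open>n\<close> to base \<open>k\<close>,
    and \<open>X\<close> equals \<open>n / l\<close>.\<close>
  define l where "l = ln (real n) / ln (real k)"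
  define X where "X = real n * (ln (real k) / ln (real n))"
  have lnk: "ln (real k) \<ge> 1 / 2" and lnn: "ln (real n) > 0"
  proof -
    have "1 / 2 \<le> ln (2 :: real)" using ln2_ge_two_thirds by simp
    also have "\<dots> \<le> ln (real k)" using assms by simp
    finally show "ln (real k) \<ge> 1 / 2" .
  qed (use assms in simp)
  have l: "l > 0" unfolding l_def using lnk lnn by (intro divide_pos_pos) auto
  have X: "X = real n / l" by (simp add: X_def l_def)
  \<comment> \<open>As \<open>h \<le> k ^ 5\<close> below, this depth keeps the batch cost
    \<open>k * h ^ L\<close> at most \<open>n ^ (3 / 5)\<close> once \<open>L \<ge> 1\<close>, while
    the saving \<open>L + 2\<close> is still at least \<open>l / 10\<close>.\<close>
  define L where "L = nat \<lfloor>l / 10\<rfloor>"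
  have L: "real L \<le> l / 10" "l / 10 \<le> real L + 2" unfolding L_def using l by linarith+
  \<comment> \<open>The parameter \<open>j = e + 1\<close> of \<open>learn_code\<close> satisfies
    \<open>k \<le> 2 ^ j \<le> 2 * k\<close>, so \<open>h\<close> is at most
    \<open>8 * k ^ 2\<close>; finally \<open>8 \<le> k ^ 3\<close>.\<close>
  obtain e where e: "2 ^ e \<le> k" "k < 2 ^ (e + 1)" using ex_power_ivl1[of 2 k] assms(2) by auto
  define h :: nat where "h = 2 ^ (2 * (e + 1) + 1)"
  have "h = 8 * (2 ^ e) ^ 2" by (simp add: h_def power_mult[symmetric] mult.commute)
  also have "\<dots> \<le> 8 * k ^ 2" using e(1) by (intro mult_left_mono power_mono) auto
  also have "\<dots> \<le> k ^ 3 * k ^ 2" using power_mono[OF assms(2), of 3] by (intro mult_right_mono) auto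
  also have "\<dots> = k ^ 5" by (simp add: power_add[symmetric])
  finally have h: "h \<le> k ^ 5" .
  define a where "a = h ^ L * (L + 2)"
  define g where "g = n div (k - 1) + 1"
  have "min_queries n k \<le> 2 * ((2 * g div a + 1) * (h ^ L * (97 * k)))"
    using learn_code[OF assms(2), of "e + 1" n L] e(2) assms(2) unfolding g_def a_def h_def
    by (intro min_queries_le_learn) auto
  then have "real (min_queries n k) \<le> real (2 * ((2 * g div a + 1) * (h ^ L * (97 * k))))"
    by (simp only: of_nat_le_iff)
  also have "\<dots> = 194 * real k * real (h ^ L) * (real (2 * g div a) + 1)" by (simp add: algebra_simps)
  also have "\<dots> \<le> 194 * real k * real (h ^ L) * (2 * real g / real a + 1)"
    using of_nat_div_le_of_nat[of "2 * g" a] by (intro mult_left_mono add_right_mono) auto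
  also have "\<dots> = 194 * (2 * (real k * real g) / (real L + 2) + real k * real (h ^ L))"
  proof -
    have "194 * K * H * (2 * G / (H * M) + 1) = 194 * (2 * (K * G) / M + K * H)"
      if "H > 0" "M > 0" for K H G M :: real using that by (simp add: field_simps)
    moreover have "real (h ^ L) > 0" "real L + 2 > 0" by (simp_all add: h_def)
    moreover have "real a = real (h ^ L) * (real L + 2)" by (simp add: a_def algebra_simps)
    ultimately show ?thesis by metis
  qed
  finally have main: "real (min_queries n k)
      \<le> 194 * (2 * (real k * real g) / (real L + 2) + real k * real (h ^ L))" .
  \<comment> \<open>This uses \<open>k / (k - 1) \<le> 2\<close>; the extra \<open>k\<close> comes
    from the summand 1 in \<open>g\<close>.\<close>
  have kg: "real k * real g \<le> 2 * real n + real k"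
  proof -
    have "real (n div (k - 1)) \<le> real n / real (k - 1)" by (rule of_nat_div_le_of_nat)
    then have "real k * real (n div (k - 1)) \<le> real k * (real n / (real k - 1))"
      using assms by (intro mult_left_mono) (auto simp: of_nat_diff)
    also have "\<dots> \<le> 2 * real n"
    proof -
      have "real k * real n \<le> (2 * real k - 2) * real n" using assms by (intro mult_right_mono) auto
      then show ?thesis using assms by (simp add: field_simps)
    qed
    finally show ?thesis by (simp add: g_def algebra_simps)
  qed
  have first: "2 * (real k * real g) / (real L + 2) \<le> 40 * X + real k"
  proof -
    have "2 * (real k * real g) / (real L + 2) \<le> (4 * real n + 2 * real k) / (real L + 2)"
      using kg by (intro divide_right_mono) auto
    also have "\<dots> = 4 * real n / (real L + 2) + 2 * real k / (real L + 2)" by (simp add: add_divide_distrib)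
    also have "4 * real n / (real L + 2) \<le> 4 * real n / (l / 10)"
      using L l by (intro divide_left_mono mult_pos_pos) auto
    also have "4 * real n / (l / 10) = 40 * X" unfolding X by simp
    also have "2 * real k / (real L + 2) \<le> 2 * real k / 2" by (intro divide_left_mono) auto
    finally show ?thesis by simp
  qed
  \<comment> \<open>For \<open>L = 0\<close> the left side is \<open>k\<close>. Otherwise
    \<open>l \<ge> 10\<close>, so the exponent \<open>1 + 5 * L\<close> is at most
    \<open>3 / 5 * l\<close>, and the remaining factor \<open>n ^ (2 / 5)\<close> absorbs the
    logarithm.\<close>
  have second: "real k * real (h ^ L) \<le> real k + 5 * X"
  proof (cases "L = 0")
    case True
    then show ?thesis unfolding X using l by simp
  next
    case False
    define m where "m = ln (real n)"
    have ml: "m = l * ln (real k)" using lnk by (simp add: m_def l_def)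
    have "real L \<ge> 1" using False by simp
    then have "l \<ge> 10" using L by linarith
    have "real k * real (h ^ L) \<le> real k * (real k ^ 5) ^ L"
      using h by (intro mult_left_mono) (simp_all add: power_mono flip: of_nat_power)
    also have "\<dots> = exp ((1 + 5 * real L) * ln (real k))"
    proof -
      have "real k * (real k ^ 5) ^ L = real k ^ (1 + 5 * L)" by (simp add: power_mult power_add)
      also have "\<dots> = exp (real (1 + 5 * L) * ln (real k))"
        unfolding exp_of_nat_mult using assms by simp
      finally show ?thesis by simp
    qed
    also have "\<dots> \<le> exp (3 / 5 * m)"
    proof -
      have "1 + 5 * real L \<le> 3 / 5 * l" using L(1) \<open>l \<ge> 10\<close> by linarith
      then have "(1 + 5 * real L) * ln (real k) \<le> 3 / 5 * l * ln (real k)"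
        using lnk by (intro mult_right_mono) auto
      then show ?thesis unfolding ml by simp
    qed
    also have "\<dots> \<le> 5 * X"
    proof -
      \<comment> \<open>That is, \<open>ln n\<close> is at most
        \<open>5 / 2 * n ^ (2 / 5)\<close>.\<close>
      have "2 / 5 * m \<le> exp (2 / 5 * m)" using exp_ge_add_one_self[of "2 / 5 * m"] by linarith
      then have "exp (3 / 5 * m) * (2 / 5 * m) \<le> exp (3 / 5 * m) * exp (2 / 5 * m)"
        by (intro mult_left_mono) auto
      also have "\<dots> = exp m" unfolding exp_add[symmetric] by simp
      also have "\<dots> = real n" using assms by (simp add: m_def)
      finally have "exp (3 / 5 * m) * (2 / 5 * m) \<le> real n" .
      then have "exp (3 / 5 * m) \<le> 5 / 2 * real n / m" using lnn by (simp add: m_def field_simps)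
      also have "\<dots> \<le> 5 * (real n * (ln (real k) / m))"
      proof -
        have "real n * (5 / 2) \<le> real n * (5 * ln (real k))" using lnk by (intro mult_left_mono) auto
        then show ?thesis using lnn by (simp add: m_def field_simps)
      qed
      finally show ?thesis by (simp add: X_def m_def)
    qed
    finally show ?thesis by simp
  qed
  have "X \<ge> 0" unfolding X using l by simp
  note main
  also have "194 * (2 * (real k * real g) / (real L + 2) + real k * real (h ^ L))
      \<le> 194 * ((40 * X + real k) + (real k + 5 * X))"
    using first second by (intro mult_left_mono add_mono) auto
  \<comment> \<open>The coefficients are \<open>194 * 45 = 8730\<close> and
    \<open>194 * 2 = 388\<close>.\<close>
  also have "\<dots> \<le> 10000 * (X + real k)" using \<open>X \<ge> 0\<close> by simp
  finally show ?thesis unfolding X_def .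
qed

text \<open>The range starts at \<open>n = 2\<close> because the denominator
  \<open>ln (real n)\<close> vanishes at \<open>n = 1\<close>.\<close>

theorem theorem1:
  shows "\<exists>c C :: real. c > 0 \<and> C > 0 \<and>
    (\<forall>n k :: nat. n \<ge> 2 \<longrightarrow> k \<ge> 2 \<longrightarrow>
       c * (real n * (ln (real k) / ln (real n)) + real k) \<le> real (min_queries n k) \<and>
       real (min_queries n k) \<le> C * (real n * (ln (real k) / ln (real n)) + real k))"
proof (intro exI conjI allI impI)
  show "(0 :: real) < 1 / 4" "(0 :: real) < 10000" by simp_all
qed (rule min_queries_ge min_queries_le; assumption)+

end
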